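(* Let $\mathcal{G}$ be a finite connected graph, $V$ a real function on its vertices, and let $k_{\mathrm{eq}}(x,y)\ge 0$, nonzero exactly when $\{x,y\}$ is an edge of $\mathcal{G}$, satisfy detailed balance $\frac{k_{\mathrm{eq}}(x,y)}{k_{\mathrm{eq}}(y,x)}=e^{V(x)-V(y)}$ for every edge $\{x,y\}$. Let $s(x,y)=-s(y,x)$ be real numbers attached to the directed edges. For real $\varepsilon$, let $\rho^s_\varepsilon$ be the unique stationary probability distribution of the Markov jump process with rates $k(x,y)=k_{\mathrm{eq}}(x,y)\,e^{\frac{\varepsilon}{2}s(x,y)}$, so that $\rho^s_0(x)\propto e^{-V(x)}$. Then for every vertex $x$, as $\varepsilon\to 0$, $$\frac{\rho^s_\varepsilon(x)}{\rho^s_0(x)}=1+\varepsilon\sum_y\rho^s_0(y)\,\big\langle S^1_{\mathcal{T}}(y\to x)\big\rangle^{\mathrm{eq}}_x+O(\varepsilon^2),$$ where the sum is over all vertices $y$ and $\langle\cdot\rangle_x^{\mathrm{eq}}$ is the expectation over spanning trees $\mathcal{T}$ in the equilibrium tree-ensemble attached to $x$.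
   Context: A stationary distribution for rates $k$ is a probability distribution $\rho$ with $\sum_y [k(x,y)\rho(x)-k(y,x)\rho(y)]=0$ for all $x$. For a spanning tree $\mathcal{T}$ of $\mathcal{G}$, $\mathcal{T}_x$ denotes the in-tree to $x$, obtained by orienting every edge of $\mathcal{T}$ towards $x$. The equilibrium tree-ensemble attached to $x$ is the probability measure on spanning trees $$\langle g(\mathcal{T})\rangle^{\mathrm{eq}}_x=\frac{\sum_{\mathcal{T}}g(\mathcal{T})\prod_{(z,z')\in\mathcal{T}_x}k_{\mathrm{eq}}(z,z')}{\sum_{\mathcal{T}}\prod_{(z,z')\in\mathcal{T}_x}k_{\mathrm{eq}}(z,z')},$$ with sums over all spanning trees of $\mathcal{G}$. $S^1_{\mathcal{T}}(y\to x)$ is the sum of $s(u,v)$ over the directed edges $(u,v)$ of the unique path in $\mathcal{T}$ from $y$ to $x$ (equal to $0$ if $y=x$). *)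

theory Defs
  imports "Graph_Theory.Digraph_Component" "HOL-Library.Landau_Symbols"
begin

text \<open>
  An undirected simple graph is a \<^locale>\<open>pair_graph\<close>: a finite, loop-free, symmetric relation
  on its vertices, each undirected edge being represented by its two arcs.

  The constants \<^const>\<open>forest\<close> and \<^const>\<open>spanning_tree\<close> of the library cannot be used for such
  graphs, since they count the closed walk \<open>a, b, a\<close> as a cycle. In a simple undirected graph the
  cycles are exactly the cycles of the symmetric digraph that have length at least 3.
\<close>

definition spanning_trees :: "'v pair_pre_digraph \<Rightarrow> 'v pair_pre_digraph set" where
  "spanning_trees G =
    {T. pair_graph T \<and> spanning (with_proj T) (with_proj G) \<and>
        Digraph_Component.connected (with_proj T) \<and>
        \<not> (\<exists>p. pre_digraph.cycle (with_proj T) p \<and> 3 \<le> length p)}"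

text \<open>
  The arc \<open>(z, z')\<close> of a tree points towards \<open>x\<close> iff it is the first arc of the path from \<open>z\<close> to \<open>x\<close>.
\<close>

definition in_tree :: "'v pair_pre_digraph \<Rightarrow> 'v \<Rightarrow> ('v \<times> 'v) set" where
  "in_tree T x = {(z, z') \<in> parcs T. \<exists>p. pre_digraph.apath (with_proj T) z ((z, z') # p) x}"

definition in_tree_weight :: "('v \<Rightarrow> 'v \<Rightarrow> real) \<Rightarrow> 'v pair_pre_digraph \<Rightarrow> 'v \<Rightarrow> real" where
  "in_tree_weight k T x = (\<Prod>(z, z')\<in>in_tree T x. k z z')"

definition tree_expectation ::
  "'v pair_pre_digraph \<Rightarrow> ('v \<Rightarrow> 'v \<Rightarrow> real) \<Rightarrow> 'v \<Rightarrow> ('v pair_pre_digraph \<Rightarrow> real) \<Rightarrow> real" where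
  "tree_expectation G k x g =
    (\<Sum>T\<in>spanning_trees G. g T * in_tree_weight k T x) /
    (\<Sum>T\<in>spanning_trees G. in_tree_weight k T x)"

definition tree_path :: "'v pair_pre_digraph \<Rightarrow> 'v \<Rightarrow> 'v \<Rightarrow> ('v \<times> 'v) list" where
  "tree_path T y x = (THE p. pre_digraph.apath (with_proj T) y p x)"

definition tree_path_sum ::
  "('v \<Rightarrow> 'v \<Rightarrow> real) \<Rightarrow> 'v pair_pre_digraph \<Rightarrow> 'v \<Rightarrow> 'v \<Rightarrow> real" where
  "tree_path_sum s T y x = (\<Sum>(u, v)\<leftarrow>tree_path T y x. s u v)"

text \<open>
  Distributions on a vertex set \<open>X\<close> are extended by \<open>0\<close> outside of \<open>X\<close>, so that uniqueness of a
  stationary distribution is equality of functions.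
\<close>

definition is_stationary_distribution ::
  "'v set \<Rightarrow> ('v \<Rightarrow> 'v \<Rightarrow> real) \<Rightarrow> ('v \<Rightarrow> real) \<Rightarrow> bool" where
  "is_stationary_distribution X k \<rho> \<longleftrightarrow>
    (\<forall>x\<in>X. 0 \<le> \<rho> x) \<and> (\<forall>x. x \<notin> X \<longrightarrow> \<rho> x = 0) \<and> (\<Sum>x\<in>X. \<rho> x) = 1 \<and>
    (\<forall>x\<in>X. (\<Sum>y\<in>X. k x y * \<rho> x - k y x * \<rho> y) = 0)"

definition stationary_distribution :: "'v set \<Rightarrow> ('v \<Rightarrow> 'v \<Rightarrow> real) \<Rightarrow> 'v \<Rightarrow> real" where
  "stationary_distribution X k = (THE \<rho>. is_stationary_distribution X k \<rho>)"

definition perturbed_rate ::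
  "('v \<Rightarrow> 'v \<Rightarrow> real) \<Rightarrow> ('v \<Rightarrow> 'v \<Rightarrow> real) \<Rightarrow> real \<Rightarrow> 'v \<Rightarrow> 'v \<Rightarrow> real" where
  "perturbed_rate k_eq s \<epsilon> x y = k_eq x y * exp (\<epsilon> / 2 * s x y)"

end

theory Submission
  imports Defs "HOL-Real_Asymp.Real_Asymp"
begin

text \<open>
  By detailed balance the weight of an in-tree is, up to a factor depending only on its root, the
  product over its edges of the conductances \<open>c(x,y) = \<rho>\<^sub>0(x) k(x,y) = c(y,x)\<close>, so all the
  equilibrium tree-ensembles coincide. Since path sums in a tree are differences of a potential, the
  claimed coefficient \<open>f\<close> has \<open>\<rho>\<^sub>0\<close>-mean \<open>0\<close> and \<open>f(x) - f(y) = - \<langle>S(x \<rightarrow> y)\<rangle>\<close>. The linear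
  response equation \<open>\<Sum>\<^sub>y c(x,y) (f(x) - f(y) + s(x,y)) = 0\<close> is then Kirchhoff's theorem, which a
  sign-reversing involution on unicyclic graphs proves. Finally the weighted Laplacian is bounded
  below on functions of mean \<open>0\<close>; applied twice, this bound gives first
  \<open>\<rho>\<^sub>\<epsilon>/\<rho>\<^sub>0 = 1 + O(\<epsilon>)\<close> and then the expansion to second order.
\<close>

section \<open>Trees as symmetric relations\<close>

text \<open>The expansion does not come from differentiating \<open>\<rho>\<close> in \<epsilon>:
  all that is known of it is that it solves the balance equations. Divided by the equilibrium
  density, these have conductances times \<open>exp (\<epsilon>/2 * s x y)\<close> in one direction
  and \<open>exp (- (\<epsilon>/2 * s x y))\<close> in the other. Both halves contribute to first
  order, hence the full \<open>s x y\<close> in the response equation.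

  The combinatorial obstacle is that Kirchhoff's argument exchanges edges on the cycle closed by a
  new edge, which is heavy with arc lists. A tree is therefore a symmetric relation that connects
  the vertices and in which every edge is a bridge: exchange arguments become statements about
  reachability, and lists occur only where cycles, in-trees and path sums are translated. Since the
  empty walk joins \<open>u\<close> to itself, the bridge condition also excludes loops.\<close>

definition tree_rel :: "'v set \<Rightarrow> 'v rel \<Rightarrow> bool" where
  "tree_rel X E \<longleftrightarrow> E \<subseteq> X \<times> X \<and> sym E \<and> (\<forall>u\<in>X. \<forall>v\<in>X. (u, v) \<in> E\<^sup>*) \<and>
    (\<forall>u v. (u, v) \<in> E \<longrightarrow> (u, v) \<notin> (E - {(u, v), (v, u)})\<^sup>*)"

lemma sym_rtranclD: "sym R \<Longrightarrow> (a, b) \<in> R\<^sup>* \<Longrightarrow> (b, a) \<in> R\<^sup>*"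
  by (meson sym_rtrancl symD)

lemma sym_minus_edge: "sym E \<Longrightarrow> sym (E - {(u, v), (v, u)})"
  by (auto simp: sym_def)

text \<open>Of several crossings of the edge at most one need be kept, since the rest can be
  short-cut. This is how connectivity is followed when an edge is deleted.\<close>

lemma rtrancl_edge_cases:
  assumes "(a, b) \<in> E\<^sup>*" and "E \<subseteq> R \<union> {(u, v), (v, u)}"
  shows "(a, b) \<in> R\<^sup>* \<or> (a, u) \<in> R\<^sup>* \<and> (v, b) \<in> R\<^sup>* \<or> (a, v) \<in> R\<^sup>* \<and> (u, b) \<in> R\<^sup>*"
  using assms(1)
proof (induction rule: rtrancl_induct)
  case base
  then show ?case by simp
next
  case (step b c)
  from step.hyps(2) assms(2) consider "(b, c) \<in> R" | "b = u" "c = v" | "b = v" "c = u"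
    by blast
  then show ?case
    using step.IH by cases (auto intro: rtrancl_into_rtrancl)
qed

lemma tree_relD:
  assumes "tree_rel X E"
  shows "E \<subseteq> X \<times> X" and "sym E" and "u \<in> X \<Longrightarrow> v \<in> X \<Longrightarrow> (u, v) \<in> E\<^sup>*"
    and "(u, v) \<in> E \<Longrightarrow> (u, v) \<notin> (E - {(u, v), (v, u)})\<^sup>*"
  using assms unfolding tree_rel_def by blast+

text \<open>The witness \<open>p\<close> comes from the last departure of the walk from
  \<open>x\<close>: each return to \<open>x\<close> discards what was built so far.\<close>

lemma ex_first_step:
  assumes "(x, y) \<in> E\<^sup>*" and "x \<noteq> y"
  shows "\<exists>p. (x, p) \<in> E \<and> (p, y) \<in> (E - {(x, p), (p, x)})\<^sup>*"
proof -
  have "y = x \<or> (\<exists>p. (x, p) \<in> E \<and> (p, y) \<in> (E - {(x, p), (p, x)})\<^sup>*)"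
    using assms(1)
  proof (induction rule: rtrancl_induct)
    case base
    then show ?case by simp
  next
    case (step y z)
    then show ?case
      by (cases "z = x \<or> y = x") (auto intro: rtrancl_into_rtrancl)
  qed
  with assms(2) show ?thesis by auto
qed

text \<open>Two different continuations would join \<open>p\<close> to \<open>q\<close> without the
  two edges at \<open>x\<close>; then \<open>p\<close>, \<open>q\<close>, \<open>x\<close> is a
  detour around the bridge \<open>{x, p}\<close>.\<close>

lemma first_step_unique:
  assumes "tree_rel X E"
    and p: "(x, p) \<in> E" "(p, y) \<in> (E - {(x, p), (p, x)})\<^sup>*"
    and q: "(x, q) \<in> E" "(q, y) \<in> (E - {(x, q), (q, x)})\<^sup>*"
  shows "p = q"
proof (rule ccontr)
  assume ne: "p \<noteq> q"
  note T = tree_relD[OF assms(1)]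
  define R where "R = E - {(x, p), (p, x)} - {(x, q), (q, x)}"
  have symR: "sym R"
    unfolding R_def by (intro sym_minus_edge T)
  have bridge: "(r, x) \<notin> (E - {(x, r), (r, x)})\<^sup>*" if "(x, r) \<in> E" for r
    using T(4)[OF that] sym_rtranclD[OF sym_minus_edge[OF T(2)]] by metis
  \<comment> \<open>Stated for \<open>a\<close> and \<open>b\<close> so that \<open>p\<close> and
    \<open>q\<close> can take both roles. A route from \<open>a\<close> that crosses
    \<open>{x, b}\<close> would first reach \<open>x\<close> or \<open>b\<close> without
    \<open>{x, a}\<close>, and either bypasses that bridge.\<close>
  have to_y: "(a, y) \<in> R\<^sup>*"
    if ab: "{a, b} = {p, q}" and a: "(x, a) \<in> E" "(a, y) \<in> (E - {(x, a), (a, x)})\<^sup>*"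
      and b: "(x, b) \<in> E" for a b
  proof -
    have R: "R = E - {(x, a), (a, x)} - {(x, b), (b, x)}" and "a \<noteq> b"
      using ab ne unfolding R_def by (auto simp: doubleton_eq_iff)
    have Ra: "R \<subseteq> E - {(x, a), (a, x)}"
      using R by auto
    have xb: "(b, x) \<in> E - {(x, a), (a, x)}"
      using b \<open>a \<noteq> b\<close> T(2) by (auto dest: symD)
    have not: "(a, x) \<notin> R\<^sup>*" "(a, b) \<notin> R\<^sup>*"
      using bridge[OF a(1)] rtrancl_mono[OF Ra] rtrancl_into_rtrancl[OF _ xb] by blast+
    have "E - {(x, a), (a, x)} \<subseteq> R \<union> {(x, b), (b, x)}"
      using R by auto
    from rtrancl_edge_cases[OF a(2) this] not show ?thesis by blast
  qed
  have "(p, y) \<in> R\<^sup>*" "(q, y) \<in> R\<^sup>*"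
    using to_y[of p q] to_y[of q p] p q by auto
  then have "(p, q) \<in> R\<^sup>*"
    using symR by (meson sym_rtranclD rtrancl_trans)
  then have "(p, q) \<in> (E - {(x, p), (p, x)})\<^sup>*"
    using rtrancl_mono[of R "E - {(x, p), (p, x)}"] unfolding R_def by blast
  moreover have "(q, x) \<in> E - {(x, p), (p, x)}"
    using q(1) ne T(2) by (auto dest: symD)
  ultimately show False
    using bridge[OF p(1)] by (meson rtrancl_into_rtrancl)
qed

text \<open>The new edge closes exactly one cycle, and the assumptions on \<open>p\<close> put
  \<open>{x, p}\<close> on it, so dropping this edge restores a tree.\<close>

lemma tree_rel_swap:
  assumes "tree_rel X E"
    and xy: "x \<in> X" "y \<in> X" "(x, y) \<notin> E" "x \<noteq> y"
    and p: "(x, p) \<in> E" "(p, y) \<in> (E - {(x, p), (p, x)})\<^sup>*"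
  shows "tree_rel X (E - {(x, p), (p, x)} \<union> {(x, y), (y, x)})"
proof -
  note T = tree_relD[OF assms(1)]
  define R where "R = E - {(x, p), (p, x)}"
  define E' where "E' = R \<union> {(x, y), (y, x)}"
  have symR: "sym R"
    unfolding R_def by (intro sym_minus_edge T)
  then have symE': "sym E'"
    unfolding E'_def by (auto simp: sym_def)
  have py: "(p, y) \<in> R\<^sup>*" and xp: "(x, p) \<notin> R\<^sup>*"
    using p T(4) unfolding R_def by auto
  have yx: "(y, x) \<notin> E"
    using xy T(2) by (auto dest: symD)
  have "(p, x) \<in> E'\<^sup>*"
    using py rtrancl_mono[of R E'] unfolding E'_def by (auto intro: rtrancl_into_rtrancl)
  then have "E \<subseteq> E'\<^sup>*"
    using sym_rtranclD[OF symE'] unfolding E'_def R_def by auto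
  then have conn: "E\<^sup>* \<subseteq> E'\<^sup>*"
    by (metis rtrancl_mono rtrancl_idemp)
  \<comment> \<open>This refutes a bypass of an old edge through the new one. If the route from
    \<open>p\<close> to \<open>y\<close> avoids \<open>{u, v}\<close>, it yields with
    \<open>{x, p}\<close> a bypass inside \<open>E\<close>; if it crosses \<open>{u, v}\<close>, one
    direction bypasses \<open>{x, p}\<close> and the other bypasses \<open>{u, v}\<close>.\<close>
  have key: False
    if uv: "(u, v) \<in> R" and ux: "(u, x) \<in> (R - {(u, v), (v, u)})\<^sup>*"
      and yv: "(y, v) \<in> (R - {(u, v), (v, u)})\<^sup>*" for u v
  proof -
    define Q where "Q = R - {(u, v), (v, u)}"
    have symQ: "sym Q"
      unfolding Q_def by (intro sym_minus_edge symR)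
    note tr = rtrancl_trans and sy = sym_rtranclD[OF symQ]
    have QE: "Q\<^sup>* \<subseteq> (E - {(u, v), (v, u)})\<^sup>*"
      by (rule rtrancl_mono) (auto simp: Q_def R_def)
    have QR: "Q\<^sup>* \<subseteq> R\<^sup>*"
      by (rule rtrancl_mono) (auto simp: Q_def)
    have uvE: "(u, v) \<notin> (E - {(u, v), (v, u)})\<^sup>*"
      using uv T(4) unfolding R_def by auto
    have xpE: "(x, p) \<in> E - {(u, v), (v, u)}"
      using p(1) uv symR unfolding R_def by (auto simp: sym_def)
    have "R \<subseteq> Q \<union> {(u, v), (v, u)}"
      unfolding Q_def by auto
    from rtrancl_edge_cases[OF py this] consider
      "(p, y) \<in> Q\<^sup>*" | "(p, u) \<in> Q\<^sup>*" "(v, y) \<in> Q\<^sup>*" | "(p, v) \<in> Q\<^sup>*" "(u, y) \<in> Q\<^sup>*"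
      by blast
    then show False
    proof cases
      case 1
      then have "(p, v) \<in> Q\<^sup>*"
        using yv unfolding Q_def by (rule tr)
      with ux QE xpE have "(u, x) \<in> (E - {(u, v), (v, u)})\<^sup>*" "(p, v) \<in> (E - {(u, v), (v, u)})\<^sup>*"
        unfolding Q_def by blast+
      with xpE have "(u, v) \<in> (E - {(u, v), (v, u)})\<^sup>*"
        by (meson rtrancl_into_rtrancl tr)
      with uvE show False by blast
    next
      case 2
      then have "(p, x) \<in> Q\<^sup>*"
        using ux unfolding Q_def by (blast intro: tr)
      then have "(x, p) \<in> R\<^sup>*"
        using sy QR by blast
      with xp show False by blast
    next
      case 3
      then have "(u, v) \<in> Q\<^sup>*"
        using yv unfolding Q_def by (blast intro: tr)
      with QE uvE show False by blast
    qed
  qed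
  have bridge: "(u, v) \<notin> (E' - {(u, v), (v, u)})\<^sup>*" if uv: "(u, v) \<in> E'" for u v
  proof
    assume c: "(u, v) \<in> (E' - {(u, v), (v, u)})\<^sup>*"
    show False
    proof (cases "(u, v) = (x, y) \<or> (u, v) = (y, x)")
      case True
      then have "E' - {(u, v), (v, u)} = R"
        using xy yx unfolding E'_def R_def by auto
      with c True symR have "(x, y) \<in> R\<^sup>*"
        by (auto dest: sym_rtranclD)
      with py symR have "(x, p) \<in> R\<^sup>*"
        by (meson rtrancl_trans sym_rtranclD)
      with xp show False by blast
    next
      case False
      with uv have uvR: "(u, v) \<in> R"
        unfolding E'_def by auto
      then have vuR: "(v, u) \<in> R"
        using symR by (auto dest: symD)
      define Q where "Q = R - {(u, v), (v, u)}"
      have Q': "Q = R - {(v, u), (u, v)}"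
        unfolding Q_def by auto
      have symQ: "sym Q"
        unfolding Q_def by (intro sym_minus_edge symR)
      have "Q \<subseteq> E - {(u, v), (v, u)}"
        unfolding Q_def R_def by auto
      then have "(u, v) \<notin> Q\<^sup>*"
        using T(4)[of u v] uvR rtrancl_mono unfolding R_def by blast
      moreover have "E' - {(u, v), (v, u)} \<subseteq> Q \<union> {(x, y), (y, x)}"
        unfolding Q_def E'_def by auto
      ultimately consider "(u, x) \<in> Q\<^sup>*" "(y, v) \<in> Q\<^sup>*" | "(u, y) \<in> Q\<^sup>*" "(x, v) \<in> Q\<^sup>*"
        using rtrancl_edge_cases[OF c] by blast
      then show False
        using key[OF uvR] key[OF vuR] sym_rtranclD[OF symQ] unfolding Q_def[symmetric] Q'[symmetric]
        by cases blast+
    qed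
  qed
  have "E' \<subseteq> X \<times> X"
    using T(1) xy unfolding E'_def R_def by auto
  then have "tree_rel X E'"
    unfolding tree_rel_def using symE' conn T(3) bridge by blast
  then show ?thesis
    unfolding E'_def R_def .
qed

text \<open>Deleting an edge that is not a bridge keeps connectedness, and this stops when only
  bridges are left. The result makes the total tree weight positive, so that it can be divided
  by.\<close>

lemma ex_spanning_tree_rel:
  assumes "finite A" and "A \<subseteq> X \<times> X" and "sym A" and "\<And>u v. u \<in> X \<Longrightarrow> v \<in> X \<Longrightarrow> (u, v) \<in> A\<^sup>*"
  shows "\<exists>E\<subseteq>A. tree_rel X E"
  using assms
proof (induction A rule: finite_psubset_induct)
  case (psubset A)
  show ?case
  proof (cases "\<exists>u v. (u, v) \<in> A \<and> (u, v) \<in> (A - {(u, v), (v, u)})\<^sup>*")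
    case True
    then obtain u v where uv: "(u, v) \<in> A" "(u, v) \<in> (A - {(u, v), (v, u)})\<^sup>*"
      by blast
    let ?R = "A - {(u, v), (v, u)}"
    have symR: "sym ?R"
      by (intro sym_minus_edge psubset.prems)
    have "A \<subseteq> ?R\<^sup>*"
      using uv sym_rtranclD[OF symR uv(2)] by auto
    then have "A\<^sup>* \<subseteq> ?R\<^sup>*"
      by (metis rtrancl_mono rtrancl_idemp)
    then have "\<exists>E\<subseteq>?R. tree_rel X E"
      using psubset.prems uv symR by (intro psubset.IH) auto
    then show ?thesis by blast
  next
    case False
    then have "tree_rel X A"
      using psubset.prems unfolding tree_rel_def by blast
    then show ?thesis by blast
  qed
qed

text \<open>Stated for forests, because the induction deletes an edge and so disconnects. The
  potential of the rest is shifted on the component of \<open>u\<close> by its defect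
  \<open>t\<close> on the deleted edge; \<open>v\<close> is unaffected because that edge is a
  bridge.\<close>

lemma ex_potential_rel:
  fixes s :: "'v \<Rightarrow> 'v \<Rightarrow> real"
  assumes "finite E" and "sym E"
    and "\<And>u v. (u, v) \<in> E \<Longrightarrow> (u, v) \<notin> (E - {(u, v), (v, u)})\<^sup>*"
    and "\<And>u v. (u, v) \<in> E \<Longrightarrow> s u v = - s v u"
  shows "\<exists>\<phi>. \<forall>(u, v)\<in>E. \<phi> u - \<phi> v = s u v"
  using assms
proof (induction E rule: finite_psubset_induct)
  case (psubset E)
  show ?case
  proof (cases "E = {}")
    case False
    then obtain u v where uv: "(u, v) \<in> E"
      by auto
    define R where "R = E - {(u, v), (v, u)}"
    have symR: "sym R"
      unfolding R_def by (intro sym_minus_edge psubset.prems)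
    have RE: "R \<subset> E"
      using uv unfolding R_def by auto
    have "(a, b) \<notin> (R - {(a, b), (b, a)})\<^sup>*" if "(a, b) \<in> R" for a b
      using psubset.prems(2)[of a b] that RE
        rtrancl_mono[of "R - {(a, b), (b, a)}" "E - {(a, b), (b, a)}"] by blast
    then have "\<exists>\<phi>. \<forall>(a, b)\<in>R. \<phi> a - \<phi> b = s a b"
      using RE symR psubset.prems(3) by (intro psubset.IH) auto
    then obtain \<phi> where \<phi>: "\<And>a b. (a, b) \<in> R \<Longrightarrow> \<phi> a - \<phi> b = s a b"
      by blast
    define t where "t = s u v + \<phi> v - \<phi> u"
    define \<psi> where "\<psi> z = \<phi> z + (if (u, z) \<in> R\<^sup>* then t else 0)" for z
    have 1: "\<psi> u - \<psi> v = s u v"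
      using psubset.prems(2)[OF uv] unfolding \<psi>_def t_def R_def by auto
    then have 2: "\<psi> v - \<psi> u = s v u"
      using psubset.prems(3)[OF uv] by simp
    have "\<psi> a - \<psi> b = s a b" if ab: "(a, b) \<in> R" for a b
    proof -
      have "(u, a) \<in> R\<^sup>* \<longleftrightarrow> (u, b) \<in> R\<^sup>*"
        using ab symR by (meson rtrancl_into_rtrancl symD)
      then show ?thesis
        using \<phi>[OF ab] unfolding \<psi>_def by auto
    qed
    with 1 2 have "\<forall>(a, b)\<in>E. \<psi> a - \<psi> b = s a b"
      unfolding R_def by auto
    then show ?thesis by blast
  qed simp
qed

lemma potential_diff_unique:
  fixes s :: "'v \<Rightarrow> 'v \<Rightarrow> real"
  assumes "(a, b) \<in> R\<^sup>*"
    and "\<And>u v. (u, v) \<in> R \<Longrightarrow> \<phi> u - \<phi> v = s u v" and "\<And>u v. (u, v) \<in> R \<Longrightarrow> \<psi> u - \<psi> v = s u v"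
  shows "\<phi> a - \<phi> b = \<psi> a - \<psi> b"
  using assms(1)
proof (induction rule: rtrancl_induct)
  case (step y z)
  then show ?case
    using assms(2,3)[of y z] by argo
qed simp

definition first_step :: "'v rel \<Rightarrow> 'v \<Rightarrow> 'v \<Rightarrow> 'v" where
  "first_step E x y = (THE p. (x, p) \<in> E \<and> (p, y) \<in> (E - {(x, p), (p, x)})\<^sup>*)"

lemma first_step_eqI:
  assumes "tree_rel X E" and "(x, p) \<in> E" and "(p, y) \<in> (E - {(x, p), (p, x)})\<^sup>*"
  shows "first_step E x y = p"
  unfolding first_step_def using assms first_step_unique[OF assms(1)] by (intro the_equality) blast+

lemma first_step:
  assumes "tree_rel X E" and "x \<in> X" and "y \<in> X" and "x \<noteq> y"
  defines "p \<equiv> first_step E x y"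
  shows "(x, p) \<in> E" and "(p, y) \<in> (E - {(x, p), (p, x)})\<^sup>*"
  using ex_first_step[OF tree_relD(3)[OF assms(1-3)] assms(4)] first_step_eqI[OF assms(1)]
  unfolding p_def by blast+

section \<open>Kirchhoff's theorem\<close>

text \<open>An edge occurs in \<open>E\<close> as two arcs, hence the square root.\<close>

definition tree_rel_weight :: "('v \<Rightarrow> 'v \<Rightarrow> real) \<Rightarrow> 'v rel \<Rightarrow> real" where
  "tree_rel_weight c E = (\<Prod>(u, v)\<in>E. sqrt (c u v))"

lemma tree_rel_weight_insert_edge:
  assumes "finite R" and "(u, v) \<notin> R" and "(v, u) \<notin> R" and "u \<noteq> v"
    and "c u v = c v u" and "0 \<le> c u v"
  shows "tree_rel_weight c (R \<union> {(u, v), (v, u)}) = c u v * tree_rel_weight c R"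
proof -
  have "tree_rel_weight c (insert (u, v) (insert (v, u) R))
      = sqrt (c u v) * (sqrt (c v u) * tree_rel_weight c R)"
    using assms unfolding tree_rel_weight_def by (subst prod.insert; simp)+
  also have "\<dots> = c u v * tree_rel_weight c R"
    using assms by (simp flip: mult.assoc)
  finally show ?thesis
    by (simp add: Un_commute)
qed

text \<open>
  The defect \<open>s x y - (\<phi> x - \<phi> y)\<close> is the sum of \<open>s\<close> around the cycle closed by the arc \<open>(x, y)\<close>.
  Removing the other edge of this cycle at \<open>x\<close> instead yields the same cycle, of the same total
  weight, in the opposite direction, so the contributions of the pairs \<open>(E, y)\<close> cancel.
\<close>

lemma sum_tree_defects_eq_0:
  fixes c s :: "'v \<Rightarrow> 'v \<Rightarrow> real" and \<phi> :: "'v rel \<Rightarrow> 'v \<Rightarrow> real"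
  assumes "finite X" and A: "A \<subseteq> X \<times> X" "sym A" "irrefl A" and x: "x \<in> X"
    and c_sym: "\<And>u v. (u, v) \<in> A \<Longrightarrow> c u v = c v u"
    and c_nonneg: "\<And>u v. (u, v) \<in> A \<Longrightarrow> 0 \<le> c u v"
    and s_antisym: "\<And>u v. (u, v) \<in> A \<Longrightarrow> s u v = - s v u"
    and \<phi>: "\<And>E u v. E \<subseteq> A \<Longrightarrow> tree_rel X E \<Longrightarrow> (u, v) \<in> E \<Longrightarrow> \<phi> E u - \<phi> E v = s u v"
  shows "(\<Sum>E | E \<subseteq> A \<and> tree_rel X E. \<Sum>y | (x, y) \<in> A.
           tree_rel_weight c E * (c x y * (s x y - (\<phi> E x - \<phi> E y)))) = 0"
proof -
  let ?T = "{E. E \<subseteq> A \<and> tree_rel X E}" and ?N = "{y. (x, y) \<in> A}"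
  define f where
    "f = (\<lambda>(E, y). tree_rel_weight c E * (c x y * (s x y - (\<phi> E x - \<phi> E y))))"
  \<comment> \<open>If \<open>(x, y)\<close> lies in \<open>E\<close>, the defect vanishes by the
    choice of \<phi>; only pairs that close a cycle matter.\<close>
  define P where "P = {(E, y). E \<subseteq> A \<and> tree_rel X E \<and> (x, y) \<in> A \<and> (x, y) \<notin> E}"
  \<comment> \<open>The pair \<open>(E, y)\<close> stands for the unicyclic graph \<open>E\<close>
    plus \<open>{x, y}\<close>. Its cycle has two edges at \<open>x\<close>, to \<open>y\<close> and
    to \<open>p\<close>; the image is the same graph with the other one marked.\<close>
  define i where "i = (\<lambda>(E, y). let p = first_step E x y in
    (E - {(x, p), (p, x)} \<union> {(x, y), (y, x)}, p))"
  have finA: "finite A"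
    using assms(1) A(1) by (meson finite_SigmaI finite_subset)
  have i: "i q \<in> P \<and> i (i q) = q \<and> f (i q) = - f q" if "q \<in> P" for q
  proof -
    obtain E y where q: "q = (E, y)" and E: "E \<subseteq> A" "tree_rel X E" and xy: "(x, y) \<in> A" "(x, y) \<notin> E"
      using \<open>q \<in> P\<close> unfolding P_def by auto
    have y: "y \<in> X" and ne: "x \<noteq> y"
      using xy A by (auto simp: irrefl_def)
    define p where "p = first_step E x y"
    define R where "R = E - {(x, p), (p, x)}"
    define E' where "E' = R \<union> {(x, y), (y, x)}"
    have p: "(x, p) \<in> E" "(p, y) \<in> R\<^sup>*"
      unfolding R_def p_def using first_step[OF E(2) x y ne] by blast+
    have pA: "(x, p) \<in> A"
      using p(1) E by auto
    then have "x \<noteq> p"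
      using A by (auto simp: irrefl_def)
    have yx: "(y, x) \<notin> E" "(y, x) \<in> A"
      using tree_relD(2)[OF E(2)] A(2) xy by (auto dest: symD)
    have px: "(p, x) \<in> E"
      using tree_relD(2)[OF E(2)] p(1) by (auto dest: symD)
    have "p \<noteq> y"
      using p(1) xy(2) by auto
    have iq: "i q = (E', p)"
      unfolding i_def q E'_def R_def p_def by (simp add: Let_def)
    have E': "tree_rel X E'" "E' \<subseteq> A"
      using tree_rel_swap[OF E(2) x y xy(2) ne] p xy yx E unfolding E'_def R_def by auto
    have symR: "sym R"
      unfolding R_def by (intro sym_minus_edge tree_relD[OF E(2)])
    have "E' - {(x, y), (y, x)} = R"
      using xy yx unfolding E'_def R_def by auto
    then have "first_step E' x p = y"
      using p sym_rtranclD[OF symR] by (intro first_step_eqI[OF E'(1)]) (auto simp: E'_def)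
    moreover have "E' - {(x, y), (y, x)} \<union> {(x, p), (p, x)} = E"
      using p px xy yx unfolding E'_def R_def by auto
    ultimately have ii: "i (i q) = q"
      unfolding iq by (simp add: i_def q Let_def)
    have mem: "i q \<in> P"
      unfolding iq P_def using E' pA \<open>p \<noteq> y\<close> \<open>x \<noteq> p\<close> by (auto simp: E'_def R_def)
    have "finite R"
      using finA E unfolding R_def by (meson finite_Diff finite_subset)
    \<comment> \<open>Together with \<open>w2\<close> below, both pairs get the same total factor
      \<open>c x p * c x y * tree_rel_weight c R\<close>.\<close>
    then have w: "tree_rel_weight c E' = c x y * tree_rel_weight c R"
      using xy yx ne c_sym c_nonneg unfolding E'_def
      by (intro tree_rel_weight_insert_edge) (auto simp: R_def)
    have "tree_rel_weight c (R \<union> {(x, p), (p, x)}) = c x p * tree_rel_weight c R"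
      using c_sym[OF pA] c_nonneg[OF pA] \<open>x \<noteq> p\<close> \<open>finite R\<close>
      by (intro tree_rel_weight_insert_edge) (auto simp: R_def)
    moreover have "R \<union> {(x, p), (p, x)} = E"
      using p px unfolding R_def by auto
    ultimately have w2: "tree_rel_weight c E = c x p * tree_rel_weight c R"
      by simp
    have 1: "\<phi> E x - \<phi> E p = s x p"
      using \<phi>[OF E p(1)] .
    have 2: "\<phi> E' x - \<phi> E' y = s x y"
      by (rule \<phi>[OF E'(2,1)]) (simp add: E'_def)
    \<comment> \<open>The route from \<open>p\<close> to \<open>y\<close> lies in both trees, so
      both potentials drop equally along it.\<close>
    have 3: "\<phi> E p - \<phi> E y = \<phi> E' p - \<phi> E' y"
    proof (rule potential_diff_unique[OF p(2)])
      fix u v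
      assume "(u, v) \<in> R"
      then have "(u, v) \<in> E" "(u, v) \<in> E'"
        unfolding E'_def R_def by auto
      then show "\<phi> E u - \<phi> E v = s u v" "\<phi> E' u - \<phi> E' v = s u v"
        by (blast intro: \<phi>[OF E] \<phi>[OF E'(2,1)])+
    qed
    have neg: "s x p - (\<phi> E' x - \<phi> E' p) = - (s x y - (\<phi> E x - \<phi> E y))"
      using 1 2 3 by argo
    have "f (E', p) = - f (E, y)"
      unfolding f_def prod.case w w2 neg by (simp add: algebra_simps)
    then have "f (i q) = - f q"
      unfolding iq by (simp add: q)
    with ii mem show ?thesis by blast
  qed
  have "(\<Sum>q\<in>P. f q) = (\<Sum>q\<in>P. f (i q))"
    by (rule sum.reindex_bij_witness[where i = i and j = i]) (use i in auto)
  also have "\<dots> = - (\<Sum>q\<in>P. f q)"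
    using i by (simp flip: sum_negf)
  finally have "(\<Sum>q\<in>P. f q) = 0"
    by simp
  have finT: "finite ?T"
    using finA by (auto intro: finite_subset[of _ "Pow A"])
  have "?N \<subseteq> X"
    using A by auto
  then have finN: "finite ?N"
    using \<open>finite X\<close> finite_subset by blast
  have "(\<Sum>q\<in>?T \<times> ?N. f q) = (\<Sum>q\<in>P. f q)"
    using finT finN \<phi> by (intro sum.mono_neutral_right) (auto simp: P_def f_def)
  with \<open>(\<Sum>q\<in>P. f q) = 0\<close> show ?thesis
    by (simp add: sum.cartesian_product f_def)
qed

section \<open>Spanning trees and in-trees\<close>

lemma pcas_imp_rtrancl:
  "pcas u p v \<Longrightarrow> set p \<subseteq> E \<Longrightarrow> (u, v) \<in> E\<^sup>*"
  by (induction p arbitrary: u) (auto intro: converse_rtrancl_into_rtrancl)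

lemma pcas_head_in_verts: "pcas u p v \<Longrightarrow> u \<in> set (pawalk_verts u p)"
  by (cases p) auto

lemma pcas_last_in_verts: "pcas u p v \<Longrightarrow> v \<in> set (pawalk_verts u p)"
  by (induction p arbitrary: u) auto

lemma pcas_closed_distinct_Nil:
  "pcas u p u \<Longrightarrow> distinct (pawalk_verts u p) \<Longrightarrow> p = []"
  by (cases p) (auto dest: pcas_last_in_verts)

lemma pcas_arcs_verts:
  "pcas u p v \<Longrightarrow> (a, b) \<in> set p \<Longrightarrow> a \<in> set (pawalk_verts u p) \<and> b \<in> set (pawalk_verts u p)"
  by (induction p arbitrary: u) (auto dest: pcas_head_in_verts)

lemma pcas_suffix:
  assumes "pcas w p v" and "distinct (pawalk_verts w p)" and "z \<in> set (pawalk_verts w p)"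
  shows "\<exists>r. set r \<subseteq> set p \<and> pcas z r v \<and> distinct (pawalk_verts z r)"
  using assms
proof (induction p arbitrary: w)
  case (Cons e p)
  show ?case
  proof (cases "z = w")
    case True
    with Cons.prems show ?thesis by (intro exI[of _ "e # p"]) auto
  next
    case False
    then have "\<exists>r. set r \<subseteq> set p \<and> pcas z r v \<and> distinct (pawalk_verts z r)"
      using Cons.prems by (intro Cons.IH[of "snd e"]) auto
    then show ?thesis by auto
  qed
qed (auto intro: exI[of _ "[]"])

lemma rtrancl_imp_path:
  assumes "(u, v) \<in> E\<^sup>*"
  shows "\<exists>p. set p \<subseteq> E \<and> pcas u p v \<and> distinct (pawalk_verts u p)"
  using assms
proof (induction rule: converse_rtrancl_induct)
  case base
  then show ?case by (intro exI[of _ "[]"]) auto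
next
  case (step u w)
  then obtain p where p: "set p \<subseteq> E" "pcas w p v" "distinct (pawalk_verts w p)"
    by blast
  show ?case
  proof (cases "u \<in> set (pawalk_verts w p)")
    case True
    then show ?thesis using pcas_suffix[OF p(2,3) True] p(1) by blast
  next
    case False
    then show ?thesis using p step.hyps(1) by (intro exI[of _ "(u, w) # p"]) auto
  qed
qed

lemma path_not_enters_start:
  assumes "pcas u p v" and "distinct (pawalk_verts u p)"
  shows "(a, u) \<notin> set p"
proof (cases p)
  case (Cons e q)
  with assms have "(a, u) \<notin> set q" "e \<noteq> (a, u)"
    using pcas_arcs_verts[of "snd e" q v] pcas_head_in_verts[of "snd e" q v] by (cases e; auto)+
  with Cons show ?thesis by auto
qed simp

section \<open>Translation between library graphs and symmetric relations\<close>

lemma apath_with_proj_iff: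
  "pre_digraph.apath (with_proj T) u p v \<longleftrightarrow>
    u \<in> pverts T \<and> set p \<subseteq> parcs T \<and> pcas u p v \<and> distinct (pawalk_verts u p)"
  by (auto simp: pre_digraph.apath_def pre_digraph.awalk_def cas_with_proj_eq
      awalk_verts_with_proj_eq)

lemma cycle_with_proj_iff:
  "pre_digraph.cycle (with_proj T) p \<longleftrightarrow>
    (\<exists>u\<in>pverts T. set p \<subseteq> parcs T \<and> pcas u p u \<and> distinct (tl (pawalk_verts u p)) \<and> p \<noteq> [])"
  by (auto simp: pre_digraph.cycle_def pre_digraph.awalk_def cas_with_proj_eq
      awalk_verts_with_proj_eq)

lemma connected_with_proj_iff:
  assumes "pair_sym_digraph G"
  shows "Digraph_Component.connected (with_proj G) \<longleftrightarrow>
    pverts G \<noteq> {} \<and> (\<forall>u\<in>pverts G. \<forall>v\<in>pverts G. (u, v) \<in> (parcs G)\<^sup>*)"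
proof -
  interpret pair_sym_digraph G by fact
  have sym: "sym (parcs G)"
    using pair_sym_arcs unfolding symmetric_def by simp
  then have "(parcs G)\<^sup>s = parcs G"
    by (auto simp: symcl_def sym_def)
  moreover have "(u, v) \<in> rtrancl_on (pverts G) (parcs G) \<longleftrightarrow> (u, v) \<in> (parcs G)\<^sup>*"
    if "u \<in> pverts G" for u v
    using reachable_conv'[OF that, of v] by (simp add: reachable_def)
  ultimately show ?thesis
    by (simp add: connected_conv)
qed

text \<open>A cycle without its first arc is a detour around that edge, and a simple detour plus the
  edge is a cycle. The bound 3 matches the deletion of both arcs: it rules out going back along the
  same edge.\<close>

lemma acyclic_iff_bridges:
  assumes "pair_graph T"
  shows "(\<exists>p. pre_digraph.cycle (with_proj T) p \<and> 3 \<le> length p) \<longleftrightarrow>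
    (\<exists>u v. (u, v) \<in> parcs T \<and> (u, v) \<in> (parcs T - {(u, v), (v, u)})\<^sup>*)"
proof
  interpret pair_graph T by fact
  have sym: "sym (parcs T)"
    using pair_sym_arcs unfolding symmetric_def by simp
  {
    assume "\<exists>p. pre_digraph.cycle (with_proj T) p \<and> 3 \<le> length p"
    then obtain p u where u: "u \<in> pverts T" and p: "set p \<subseteq> parcs T" "pcas u p u"
      "distinct (tl (pawalk_verts u p))" "p \<noteq> []" and len: "3 \<le> length p"
      unfolding cycle_with_proj_iff by blast
    then obtain v q where pq: "p = (u, v) # q"
      by (cases p) auto
    with p have q: "set q \<subseteq> parcs T" "pcas v q u" "distinct (pawalk_verts v q)"
      and uv: "(u, v) \<in> parcs T"
      by auto
    have "(u, v) \<notin> set q"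
      by (rule path_not_enters_start[OF q(2,3)])
    \<comment> \<open>The path \<open>q\<close> starts at \<open>v\<close> and visits it once, so
      \<open>(v, u)\<close> could only be its first arc; \<open>q\<close> would end there and the
      cycle would have length 2.\<close>
    moreover have "(v, u) \<notin> set q"
    proof
      assume vu: "(v, u) \<in> set q"
      obtain e es where es: "q = e # es"
        using vu by (cases q) auto
      have "e = (v, u)"
        using vu q es pcas_arcs_verts[of "snd e" es u v u] by auto
      then have "pcas u es u" "distinct (pawalk_verts u es)"
        using q es by auto
      then have "es = []"
        by (rule pcas_closed_distinct_Nil)
      then show False
        using len pq es by simp
    qed
    ultimately have "set q \<subseteq> parcs T - {(u, v), (v, u)}"
      using q(1) by auto
    from pcas_imp_rtrancl[OF q(2) this] sym_rtranclD[OF sym_minus_edge[OF sym]] uv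
    show "\<exists>u v. (u, v) \<in> parcs T \<and> (u, v) \<in> (parcs T - {(u, v), (v, u)})\<^sup>*"
      by blast
  next
    assume "\<exists>u v. (u, v) \<in> parcs T \<and> (u, v) \<in> (parcs T - {(u, v), (v, u)})\<^sup>*"
    then obtain u v where uv: "(u, v) \<in> parcs T"
      and "(v, u) \<in> (parcs T - {(u, v), (v, u)})\<^sup>*"
      using sym_rtranclD[OF sym_minus_edge[OF sym]] by blast
    then obtain p where p: "set p \<subseteq> parcs T - {(u, v), (v, u)}" "pcas v p u"
      "distinct (pawalk_verts v p)"
      using rtrancl_imp_path by meson
    have "u \<noteq> v"
      using pair_no_loops[OF uv] by simp
    \<comment> \<open>A single arc from \<open>v\<close> to \<open>u\<close> would be
      \<open>(v, u)\<close>, which has been removed.\<close>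
    then have "p \<noteq> []" "length p \<noteq> 1"
      using p by (auto simp: length_Suc_conv)
    then have "3 \<le> length ((u, v) # p)"
      by (cases p) (auto simp: Suc_le_eq)
    moreover have "pre_digraph.cycle (with_proj T) ((u, v) # p)"
      unfolding cycle_with_proj_iff using uv p in_arcsD1[OF uv] by (intro bexI[of _ u]) auto
    ultimately show "\<exists>p. pre_digraph.cycle (with_proj T) p \<and> 3 \<le> length p"
      by blast
  }
qed

text \<open>The interface through which all sums over trees pass to \<open>tree_rel\<close>. The
  condition \<open>pverts G \<noteq> {}\<close> reflects that a connected library graph has a
  vertex.\<close>

lemma spanning_trees_iff:
  assumes "pair_graph G"
  shows "T \<in> spanning_trees G \<longleftrightarrow>
    pverts T = pverts G \<and> parcs T \<subseteq> parcs G \<and> pverts G \<noteq> {} \<and> tree_rel (pverts G) (parcs T)"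
proof -
  interpret G: pair_graph G by fact
  show ?thesis
  proof
    assume T: "T \<in> spanning_trees G"
    then interpret T: pair_graph T
      unfolding spanning_trees_def by blast
    have "pverts T = pverts G" "parcs T \<subseteq> parcs G"
      using T unfolding spanning_trees_def spanning_def subgraph_def by auto
    moreover have "sym (parcs T)"
      using T.pair_sym_arcs unfolding symmetric_def by simp
    moreover have "parcs T \<subseteq> pverts T \<times> pverts T"
      by (auto dest: T.in_arcsD1 T.in_arcsD2)
    ultimately show "pverts T = pverts G \<and> parcs T \<subseteq> parcs G \<and> pverts G \<noteq> {} \<and>
        tree_rel (pverts G) (parcs T)"
      using T acyclic_iff_bridges[OF T.pair_graph_axioms]
        connected_with_proj_iff[OF T.pair_sym_digraph_axioms]
      unfolding spanning_trees_def tree_rel_def by auto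
  next
    assume T: "pverts T = pverts G \<and> parcs T \<subseteq> parcs G \<and> pverts G \<noteq> {} \<and>
        tree_rel (pverts G) (parcs T)"
    note tr = tree_relD[OF conjunct2[OF conjunct2[OF conjunct2[OF T]]]]
    have ends: "fst e \<in> pverts T" "snd e \<in> pverts T" "fst e \<noteq> snd e" if "e \<in> parcs T" for e
      using that T tr(1) G.pair_no_loops by auto
    have fin: "finite (pverts T)" "finite (parcs T)"
      using T G.pair_finite_verts G.pair_finite_arcs finite_subset[of "parcs T" "parcs G"] by auto
    have sym: "symmetric (with_proj T)"
      using tr(2) by (simp add: symmetric_def)
    interpret T: pair_graph T
      by unfold_locales (fact ends fin sym)+
    have "spanning (with_proj T) (with_proj G)"
      using T G.wf_digraph_axioms T.wf_digraph_axioms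
      unfolding spanning_def subgraph_def compatible_def by auto
    moreover have "Digraph_Component.connected (with_proj T)"
      unfolding connected_with_proj_iff[OF T.pair_sym_digraph_axioms] using T tr(3) by auto
    ultimately show "T \<in> spanning_trees G"
      using acyclic_iff_bridges[OF T.pair_graph_axioms] tr(4) T.pair_graph_axioms
      unfolding spanning_trees_def by blast
  qed
qed

lemma sum_spanning_trees:
  fixes G :: "'v pair_pre_digraph"
  assumes "pair_graph G" and "pverts G \<noteq> {}"
  shows "(\<Sum>T\<in>spanning_trees G. f T) =
    (\<Sum>E | E \<subseteq> parcs G \<and> tree_rel (pverts G) E. f \<lparr>pverts = pverts G, parcs = E\<rparr>)"
proof -
  have eta: "\<lparr>pverts = pverts G, parcs = parcs T\<rparr> = T" if "pverts T = pverts G"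
    for T :: "'v pair_pre_digraph"
    using that by (cases T) simp
  show ?thesis
    by (rule sum.reindex_bij_witness[where j = parcs and i = "\<lambda>E. \<lparr>pverts = pverts G, parcs = E\<rparr>"])
      (simp_all add: spanning_trees_iff[OF assms(1)] assms(2) eta)
qed

section \<open>Unique paths, path sums and in-trees\<close>

lemma path_first_step:
  assumes "pcas u ((u, a) # p) v" and "set ((u, a) # p) \<subseteq> E"
    and "distinct (pawalk_verts u ((u, a) # p))"
  shows "(u, a) \<in> E" and "(a, v) \<in> (E - {(u, a), (a, u)})\<^sup>*"
proof -
  have p: "pcas a p v" "u \<notin> set (pawalk_verts a p)" "set p \<subseteq> E"
    using assms by auto
  then have "set p \<subseteq> E - {(u, a), (a, u)}"
    using pcas_arcs_verts[OF p(1)] by blast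
  with p(1) show "(a, v) \<in> (E - {(u, a), (a, u)})\<^sup>*"
    by (rule pcas_imp_rtrancl)
qed (use assms in auto)

lemma tree_path_unique:
  assumes "tree_rel X E"
    and "pcas u p v" "set p \<subseteq> E" "distinct (pawalk_verts u p)"
    and "pcas u q v" "set q \<subseteq> E" "distinct (pawalk_verts u q)"
  shows "p = q"
  using assms(2-)
proof (induction p arbitrary: u q)
  case Nil
  then show ?case
    using pcas_closed_distinct_Nil[of u q] by auto
next
  case (Cons e p)
  obtain a where e: "e = (u, a)"
    using Cons.prems by (cases e) auto
  show ?case
  proof (cases q)
    case Nil
    then show ?thesis
      using Cons.prems pcas_closed_distinct_Nil[of u "e # p"] by auto
  next
    case q: (Cons e' q')
    then obtain b where e': "e' = (u, b)"
      using Cons.prems by (cases e') auto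
    have "a = b"
      using first_step_unique[OF assms(1)] path_first_step[of u a p v E] path_first_step[of u b q' v E]
        Cons.prems unfolding q e e' by blast
    moreover have "p = q'"
      using Cons.prems \<open>a = b\<close> unfolding q e e' by (intro Cons.IH[of a q']) auto
    ultimately show ?thesis
      unfolding q e e' by simp
  qed
qed

lemma apath_tree_path:
  assumes "tree_rel (pverts T) (parcs T)" and "u \<in> pverts T" and "v \<in> pverts T"
  shows "pre_digraph.apath (with_proj T) u (tree_path T u v) v"
proof -
  obtain p where "pre_digraph.apath (with_proj T) u p v"
    using rtrancl_imp_path[OF tree_relD(3)[OF assms]] assms(2)
    unfolding apath_with_proj_iff by blast
  moreover have "q = p" if "pre_digraph.apath (with_proj T) u p v"
    "pre_digraph.apath (with_proj T) u q v" for p q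
    using that tree_path_unique[OF assms(1)] unfolding apath_with_proj_iff by blast
  ultimately show ?thesis
    unfolding tree_path_def
    by (intro theI[where P = "\<lambda>p. pre_digraph.apath (with_proj T) u p v"])
qed

lemma pcas_sum_potential:
  fixes s :: "'v \<Rightarrow> 'v \<Rightarrow> real"
  assumes "pcas u p v" and "\<And>a b. (a, b) \<in> set p \<Longrightarrow> \<phi> a - \<phi> b = s a b"
  shows "(\<Sum>(a, b)\<leftarrow>p. s a b) = \<phi> u - \<phi> v"
  using assms
proof (induction p arbitrary: u)
  case (Cons e p)
  obtain a where e: "e = (u, a)"
    using Cons.prems by (cases e) auto
  have "(\<Sum>(a, b)\<leftarrow>p. s a b) = \<phi> a - \<phi> v"
    using Cons.prems e by (intro Cons.IH) auto
  moreover have "\<phi> u - \<phi> a = s u a"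
    using Cons.prems(2) e by simp
  ultimately show ?case
    using e by simp
qed simp

lemma tree_path_sum_eq_potential:
  assumes "tree_rel (pverts T) (parcs T)" and "u \<in> pverts T" and "v \<in> pverts T"
    and "\<And>a b. (a, b) \<in> parcs T \<Longrightarrow> \<phi> a - \<phi> b = s a b"
  shows "tree_path_sum s T u v = \<phi> u - \<phi> v"
  unfolding tree_path_sum_def using apath_tree_path[OF assms(1-3)] assms(4)
  unfolding apath_with_proj_iff by (intro pcas_sum_potential) auto

text \<open>Deleting a bridge splits the tree, and the arc points towards \<open>x\<close> when
  \<open>x\<close> lies on the side of \<open>v\<close>. This replaces the path in the definition by
  reachability.\<close>

lemma in_tree_iff:
  assumes T: "tree_rel (pverts T) (parcs T)" and x: "x \<in> pverts T"
  shows "(u, v) \<in> in_tree T x \<longleftrightarrow>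
    (u, v) \<in> parcs T \<and> (v, x) \<in> (parcs T - {(u, v), (v, u)})\<^sup>*"
proof
  assume "(u, v) \<in> in_tree T x"
  then obtain p where "pre_digraph.apath (with_proj T) u ((u, v) # p) x"
    unfolding in_tree_def by auto
  then show "(u, v) \<in> parcs T \<and> (v, x) \<in> (parcs T - {(u, v), (v, u)})\<^sup>*"
    unfolding apath_with_proj_iff using path_first_step[of u v p x "parcs T"] by blast
next
  assume uv: "(u, v) \<in> parcs T \<and> (v, x) \<in> (parcs T - {(u, v), (v, u)})\<^sup>*"
  have u: "u \<in> pverts T"
    using tree_relD(1)[OF T] uv by auto
  have "(u, v) \<notin> (parcs T - {(u, v), (v, u)})\<^sup>*"
    using tree_relD(4)[OF T] uv by blast
  then have "u \<noteq> x"
    using uv sym_rtranclD[OF sym_minus_edge[OF tree_relD(2)[OF T]]] by blast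
  obtain p where p: "pre_digraph.apath (with_proj T) u p x"
    using apath_tree_path[OF T u x] by blast
  with \<open>u \<noteq> x\<close> obtain w q where q: "p = (u, w) # q"
    unfolding apath_with_proj_iff by (cases p) auto
  then have "(u, w) \<in> parcs T" "(w, x) \<in> (parcs T - {(u, w), (w, u)})\<^sup>*"
    using p path_first_step[of u w q x "parcs T"] unfolding apath_with_proj_iff by blast+
  then have "w = v"
    using first_step_unique[OF T] uv by blast
  then show "(u, v) \<in> in_tree T x"
    unfolding in_tree_def using p q uv by auto
qed

text \<open>The two sides of a bridge partition the vertices, and \<open>x\<close> lies on exactly
  one of them.\<close>

lemma in_tree_iff_converse_notin:
  assumes T: "tree_rel (pverts T) (parcs T)" and x: "x \<in> pverts T" and uv: "(u, v) \<in> parcs T"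
  shows "(u, v) \<in> in_tree T x \<longleftrightarrow> (v, u) \<notin> in_tree T x"
proof -
  let ?R = "parcs T - {(u, v), (v, u)}"
  have sym: "sym ?R"
    by (intro sym_minus_edge tree_relD[OF T])
  have vu: "(v, u) \<in> parcs T" and u: "u \<in> pverts T"
    using uv tree_relD(1,2)[OF T] by (auto dest: symD)
  have R: "parcs T - {(v, u), (u, v)} = ?R"
    by auto
  have "(u, v) \<notin> ?R\<^sup>*"
    using tree_relD(4)[OF T uv] .
  then have "\<not> ((v, x) \<in> ?R\<^sup>* \<and> (u, x) \<in> ?R\<^sup>*)"
    using sym by (meson rtrancl_trans sym_rtranclD)
  moreover have "(u, x) \<in> ?R\<^sup>* \<or> (v, x) \<in> ?R\<^sup>*"
    using rtrancl_edge_cases[OF tree_relD(3)[OF T u x], of ?R u v] by blast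
  ultimately show ?thesis
    unfolding in_tree_iff[OF T x] R using uv vu by blast
qed

text \<open>Every vertex but the root leaves by the first arc of its path to the root. A product
  over the tails thus depends only on the vertex set and the root.\<close>

lemma in_tree_tails:
  assumes T: "tree_rel (pverts T) (parcs T)" and x: "x \<in> pverts T"
  shows "bij_betw fst (in_tree T x) (pverts T - {x})"
proof -
  have "inj_on fst (in_tree T x)"
    using first_step_unique[OF T] by (auto simp: inj_on_def in_tree_iff[OF T x])
  moreover have "u \<in> pverts T - {x}" if "(u, v) \<in> in_tree T x" for u v
  proof -
    have uv: "(u, v) \<in> parcs T" "(v, x) \<in> (parcs T - {(u, v), (v, u)})\<^sup>*"
      using that unfolding in_tree_iff[OF T x] by auto
    then have "(x, v) \<in> (parcs T - {(u, v), (v, u)})\<^sup>*"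
      using sym_rtranclD[OF sym_minus_edge[OF tree_relD(2)[OF T]]] by blast
    moreover have "(u, v) \<notin> (parcs T - {(u, v), (v, u)})\<^sup>*"
      by (rule tree_relD(4)[OF T uv(1)])
    moreover have "u \<in> pverts T"
      using uv(1) tree_relD(1)[OF T] by auto
    ultimately show ?thesis
      by auto
  qed
  moreover have "u \<in> fst ` in_tree T x" if "u \<in> pverts T" "u \<noteq> x" for u
  proof -
    have "(u, first_step (parcs T) u x) \<in> in_tree T x"
      unfolding in_tree_iff[OF T x] using first_step[OF T that(1) x that(2)] by blast
    then show ?thesis by force
  qed
  ultimately show ?thesis
    unfolding bij_betw_def by fastforce
qed

text \<open>
  Detailed balance turns the weight of an in-tree into the orientation-independent product of the
  conductances \<open>c\<close> over the edges, up to a factor that depends on the root but not on the tree.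
\<close>

lemma in_tree_weight_eq:
  fixes c k :: "'v \<Rightarrow> 'v \<Rightarrow> real" and \<pi> :: "'v \<Rightarrow> real"
  assumes T: "tree_rel (pverts T) (parcs T)" and x: "x \<in> pverts T" and fin: "finite (parcs T)"
    and c: "\<And>u v. (u, v) \<in> parcs T \<Longrightarrow> c u v = \<pi> u * k u v"
    and c_sym: "\<And>u v. (u, v) \<in> parcs T \<Longrightarrow> c u v = c v u"
    and c_nonneg: "\<And>u v. (u, v) \<in> parcs T \<Longrightarrow> 0 \<le> c u v"
  shows "(\<Prod>u\<in>pverts T - {x}. \<pi> u) * in_tree_weight k T x = tree_rel_weight c (parcs T)"
proof -
  let ?I = "in_tree T x"
  have I: "?I \<subseteq> parcs T"
    unfolding in_tree_def by auto
  then have finI: "finite ?I"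
    using fin finite_subset by blast
  have sub: "(u, v) \<in> parcs T" if "(u, v) \<in> ?I" for u v
    using that I by auto
  have disj: "?I \<inter> ?I\<inverse> = {}"
    using in_tree_iff_converse_notin[OF T x] sub by auto
  have un: "parcs T = ?I \<union> ?I\<inverse>"
  proof (intro equalityI subrelI)
    fix a b
    assume "(a, b) \<in> parcs T"
    then show "(a, b) \<in> ?I \<union> ?I\<inverse>"
      using in_tree_iff_converse_notin[OF T x, of a b] by auto
  next
    fix a b
    assume "(a, b) \<in> ?I \<union> ?I\<inverse>"
    then show "(a, b) \<in> parcs T"
      using sub[of a b] sub[of b a] symD[OF tree_relD(2)[OF T], of b a] by blast
  qed
  have "tree_rel_weight c (parcs T) =
      (\<Prod>(u, v)\<in>?I. sqrt (c u v)) * (\<Prod>(u, v)\<in>?I\<inverse>. sqrt (c u v))"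
    unfolding tree_rel_weight_def using finI disj by (subst un, intro prod.union_disjoint) auto
  \<comment> \<open>Reversal preserves conductances, so both halves of the tree contribute equally
    and their square roots multiply to one factor \<open>c u v\<close> per edge.\<close>
  also have "(\<Prod>(u, v)\<in>?I\<inverse>. sqrt (c u v)) = (\<Prod>(u, v)\<in>?I. sqrt (c u v))"
    by (rule prod.reindex_bij_witness[where i = prod.swap and j = prod.swap])
      (auto dest: sub simp: c_sym)
  also have "(\<Prod>(u, v)\<in>?I. sqrt (c u v)) * (\<Prod>(u, v)\<in>?I. sqrt (c u v)) = (\<Prod>(u, v)\<in>?I. \<pi> u * k u v)"
    unfolding prod.distrib[symmetric]
    by (intro prod.cong refl) (use c c_nonneg sub in \<open>force simp: split_beta\<close>)
  also have "\<dots> = (\<Prod>e\<in>?I. \<pi> (fst e)) * in_tree_weight k T x"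
    unfolding in_tree_weight_def prod.distrib[symmetric] by (simp add: split_beta)
  also have "(\<Prod>e\<in>?I. \<pi> (fst e)) = (\<Prod>u\<in>pverts T - {x}. \<pi> u)"
    by (rule prod.reindex_bij_betw[OF in_tree_tails[OF T x]])
  finally show ?thesis by simp
qed

section \<open>Stationary distributions and their perturbation\<close>

text \<open>
  A state \<open>v\<close> is eliminated by passing to the process watched only outside of \<open>v\<close>, whose rates are
  \<open>k x y + k x v * k v y / q\<close>, where \<open>q\<close> is the total rate out of \<open>v\<close>.
\<close>

lemma ex_invariant_measure:
  fixes k :: "'v \<Rightarrow> 'v \<Rightarrow> real"
  assumes "finite X" and "X \<noteq> {}" and "\<And>x y. x \<in> X \<Longrightarrow> y \<in> X \<Longrightarrow> 0 \<le> k x y"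
  shows "\<exists>\<pi>. (\<forall>x\<in>X. 0 \<le> \<pi> x) \<and> 0 < (\<Sum>x\<in>X. \<pi> x) \<and>
    (\<forall>x\<in>X. (\<Sum>y\<in>X. k x y * \<pi> x - k y x * \<pi> y) = 0)"
  using assms
proof (induction X arbitrary: k rule: finite_ne_induct)
  case (singleton v)
  then show ?case by (intro exI[of _ "\<lambda>_. 1"]) auto
next
  case (insert v F)
  define q where "q = (\<Sum>y\<in>F. k v y)"
  have q: "0 \<le> q"
    unfolding q_def using insert.prems by (intro sum_nonneg) auto
  show ?case
  proof (cases "q = 0")
    \<comment> \<open>With no rate from \<open>v\<close> into \<open>F\<close>, the state is
      absorbing and its point mass is invariant.\<close>
    case True
    then have "k v y = 0" if "y \<in> F" for y
      using that insert.prems insert.hyps(1) unfolding q_def by (subst (asm) sum_nonneg_eq_0_iff) auto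
    then show ?thesis
      using insert.hyps by (intro exI[of _ "\<lambda>x. if x = v then 1 else 0"]) (auto intro!: sum.neutral)
  next
    case False
    \<comment> \<open>An excursion through \<open>v\<close> enters \<open>F\<close> at
      \<open>y\<close> with probability \<open>k v y / q\<close>. A positive diagonal
      \<open>k' x x\<close> may arise, but it cancels in the balance equations.\<close>
    define k' where "k' x y = k x y + k x v * k v y / q" for x y
    have "\<exists>\<pi>. (\<forall>x\<in>F. 0 \<le> \<pi> x) \<and> 0 < (\<Sum>x\<in>F. \<pi> x) \<and>
      (\<forall>x\<in>F. (\<Sum>y\<in>F. k' x y * \<pi> x - k' y x * \<pi> y) = 0)"
      using insert.prems q unfolding k'_def by (intro insert.IH) auto
    then obtain \<pi> where pos: "\<And>x. x \<in> F \<Longrightarrow> 0 \<le> \<pi> x" "0 < (\<Sum>x\<in>F. \<pi> x)"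
      and bal: "\<And>x. x \<in> F \<Longrightarrow> (\<Sum>y\<in>F. k' x y * \<pi> x - k' y x * \<pi> y) = 0"
      by blast
    \<comment> \<open>The value forced by balance at \<open>v\<close>: the outflow
      \<open>q * m\<close> equals the inflow from \<open>F\<close>.\<close>
    define m where "m = (\<Sum>x\<in>F. k x v * \<pi> x) / q"
    define \<pi>' where "\<pi>' = \<pi>(v := m)"
    have m: "0 \<le> m"
      unfolding m_def using pos insert.prems q by (intro divide_nonneg_nonneg sum_nonneg) auto
    have \<pi>': "\<pi>' v = m" "\<And>x. x \<in> F \<Longrightarrow> \<pi>' x = \<pi> x"
      using insert.hyps unfolding \<pi>'_def by auto
    have sum_\<pi>': "(\<Sum>y\<in>F. g y (\<pi>' y)) = (\<Sum>y\<in>F. g y (\<pi> y))" for g :: "'v \<Rightarrow> real \<Rightarrow> real"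
      using \<pi>' by (intro sum.cong) auto
    have "(\<Sum>y\<in>insert v F. k x y * \<pi>' x - k y x * \<pi>' y) = 0" if x: "x \<in> insert v F" for x
    proof (cases "x = v")
      case True
      have "(\<Sum>y\<in>F. k v y * m - k y v * \<pi> y) = q * m - (\<Sum>y\<in>F. k y v * \<pi> y)"
        by (simp add: sum_subtractf q_def sum_distrib_right)
      also have "\<dots> = 0"
        using False by (simp add: m_def)
      finally show ?thesis
        using True insert.hyps sum_\<pi>'[of "\<lambda>y p. k v y * m - k y v * p"] by (simp add: \<pi>')
    next
      case xv: False
      then have xF: "x \<in> F" using x by simp
      have "(\<Sum>y\<in>F. k' x y * \<pi> x - k' y x * \<pi> y) =
          (\<Sum>y\<in>F. k x y * \<pi> x - k y x * \<pi> y) +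
          ((\<Sum>y\<in>F. k v y) * (k x v * \<pi> x / q) - (\<Sum>y\<in>F. k y v * \<pi> y) * (k v x / q))"
        unfolding sum_distrib_right sum_subtractf[symmetric] sum.distrib[symmetric] k'_def
        by (intro sum.cong) (auto simp: algebra_simps)
      also have "(\<Sum>y\<in>F. k v y) * (k x v * \<pi> x / q) = k x v * \<pi> x"
        using False unfolding q_def by simp
      also have "(\<Sum>y\<in>F. k y v * \<pi> y) * (k v x / q) = k v x * m"
        unfolding m_def by simp
      finally show ?thesis
        using bal[OF xF] insert.hyps sum_\<pi>'[of "\<lambda>y p. k x y * \<pi> x - k y x * p"] xF
        by (simp add: \<pi>')
    qed
    moreover have "0 < (\<Sum>x\<in>insert v F. \<pi>' x)"
      using insert.hyps pos(2) m sum_\<pi>'[of "\<lambda>y p. p"] by (simp add: \<pi>')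
    moreover have "\<forall>x\<in>insert v F. 0 \<le> \<pi>' x"
      using pos m by (auto simp: \<pi>')
    ultimately show ?thesis by blast
  qed
qed

lemma ex_stationary_distribution:
  fixes k :: "'v \<Rightarrow> 'v \<Rightarrow> real"
  assumes "finite X" and "X \<noteq> {}" and "\<And>x y. x \<in> X \<Longrightarrow> y \<in> X \<Longrightarrow> 0 \<le> k x y"
  shows "\<exists>\<pi>. is_stationary_distribution X k \<pi>"
proof -
  obtain \<pi> where \<pi>: "\<And>x. x \<in> X \<Longrightarrow> 0 \<le> \<pi> x" "0 < (\<Sum>x\<in>X. \<pi> x)"
    "\<And>x. x \<in> X \<Longrightarrow> (\<Sum>y\<in>X. k x y * \<pi> x - k y x * \<pi> y) = 0"
    using ex_invariant_measure[of X k, OF assms] by blast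
  define Z where "Z = (\<Sum>x\<in>X. \<pi> x)"
  define \<rho> where "\<rho> x = (if x \<in> X then \<pi> x / Z else 0)" for x
  have "(\<Sum>x\<in>X. \<rho> x) = 1"
    using \<pi>(2) unfolding \<rho>_def Z_def by (simp flip: sum_divide_distrib)
  moreover have "(\<Sum>y\<in>X. k x y * \<rho> x - k y x * \<rho> y) = 0" if x: "x \<in> X" for x
  proof -
    have "(\<Sum>y\<in>X. k x y * \<rho> x - k y x * \<rho> y) = (\<Sum>y\<in>X. k x y * \<pi> x - k y x * \<pi> y) / Z"
      unfolding sum_divide_distrib using x by (intro sum.cong) (auto simp: \<rho>_def diff_divide_distrib)
    then show ?thesis using \<pi>(3)[OF x] by simp
  qed
  ultimately have "is_stationary_distribution X k \<rho>"
    unfolding is_stationary_distribution_def using \<pi>(1,2) by (auto simp: \<rho>_def Z_def)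
  then show ?thesis by blast
qed

section \<open>Lower bounds for the weighted Laplacian\<close>

text \<open>The weights may be asymmetric: besides conductances, the uniqueness proof uses
  \<open>k y x * \<pi> y\<close> for general rates.\<close>

locale irreducible_weights =
  fixes X :: "'v set" and A :: "'v rel" and a :: "'v \<Rightarrow> 'v \<Rightarrow> real"
  assumes fin: "finite X" and nonempty: "X \<noteq> {}"
    and arcs: "A \<subseteq> X \<times> X"
    and irreducible: "\<And>u v. u \<in> X \<Longrightarrow> v \<in> X \<Longrightarrow> (u, v) \<in> A\<^sup>*"
    and nonneg: "\<And>u v. u \<in> X \<Longrightarrow> v \<in> X \<Longrightarrow> 0 \<le> a u v"
    and arcs_pos: "\<And>u v. (u, v) \<in> A \<Longrightarrow> 0 < a u v"
begin

definition laplacian :: "('v \<Rightarrow> real) \<Rightarrow> 'v \<Rightarrow> real" where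
  "laplacian h x = (\<Sum>y\<in>X. a x y * (h x - h y))"

text \<open>The terms \<open>a y w * (M - h w)\<close> are nonnegative and sum to
  \<open>Q * (M - h y) + laplacian h y\<close>, so a small gap at \<open>y\<close> forces a small
  gap at each neighbour, and this spreads along a walk. The constant is fixed before
  \<open>h\<close>, which later makes it uniform in \<epsilon>.\<close>

lemma quantitative_max_principle:
  assumes "x \<in> X" and "y \<in> X"
  shows "\<exists>C\<ge>0. \<forall>h M R. (\<forall>z\<in>X. h z \<le> M) \<longrightarrow> (\<forall>z\<in>X. laplacian h z \<le> R) \<longrightarrow> 0 \<le> R \<longrightarrow>
    M - h y \<le> C * (M - h x + R)"
  using irreducible[OF assms]
proof (induction rule: rtrancl_induct)
  case base
  then show ?case by (intro exI[of _ 1]) auto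
next
  case (step y z)
  then obtain C where C: "C \<ge> 0" "\<And>h M R. (\<forall>z\<in>X. h z \<le> M) \<Longrightarrow> (\<forall>z\<in>X. laplacian h z \<le> R) \<Longrightarrow>
    0 \<le> R \<Longrightarrow> M - h y \<le> C * (M - h x + R)"
    by blast
  have y: "y \<in> X" and z: "z \<in> X"
    using step.hyps arcs by auto
  define Q where "Q = (\<Sum>w\<in>X. a y w)"
  have Q: "0 \<le> Q"
    unfolding Q_def using nonneg y by (intro sum_nonneg) auto
  have az: "0 < a y z"
    using arcs_pos step.hyps by auto
  have "M - h z \<le> (Q * C + 1) / a y z * (M - h x + R)"
    if h: "\<forall>z\<in>X. h z \<le> M" and R: "\<forall>z\<in>X. laplacian h z \<le> R" "0 \<le> R" for h M R
  proof -
    have "a y z * (M - h z) \<le> (\<Sum>w\<in>X. a y w * (M - h w))"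
      using h nonneg y z fin by (intro member_le_sum) auto
    also have "\<dots> = Q * (M - h y) + laplacian h y"
      unfolding laplacian_def Q_def sum_distrib_right sum.distrib[symmetric]
      by (intro sum.cong) (auto simp: algebra_simps)
    also have "\<dots> \<le> Q * (C * (M - h x + R)) + (M - h x + R)"
      using C(2)[OF h R] Q R y h \<open>x \<in> X\<close> by (intro add_mono mult_left_mono) (auto intro: add_increasing)
    also have "\<dots> = (Q * C + 1) * (M - h x + R)"
      by (simp add: algebra_simps)
    finally show ?thesis
      using az by (simp add: field_simps)
  qed
  then show ?case
    using Q C(1) az by (intro exI[of _ "(Q * C + 1) / a y z"]) auto
qed

text \<open>With weighted mean 0, \<open>h\<close> is nonpositive somewhere, and at a maximum point
  the gap is 0. The maximum principle between these two points bounds \<open>h\<close> from above;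
  \<open>- h\<close> gives the other sign.\<close>

lemma bounded_by_laplacian:
  fixes \<pi> :: "'v \<Rightarrow> real"
  assumes \<pi>: "\<And>x. x \<in> X \<Longrightarrow> 0 < \<pi> x"
  shows "\<exists>C\<ge>0. \<forall>h. (\<Sum>x\<in>X. \<pi> x * h x) = 0 \<longrightarrow>
    (\<forall>y\<in>X. \<bar>h y\<bar> \<le> C * (\<Sum>x\<in>X. \<bar>laplacian h x\<bar>))"
proof -
  have "\<forall>p\<in>X \<times> X. \<exists>C\<ge>0. \<forall>h M R. (\<forall>z\<in>X. h z \<le> M) \<longrightarrow> (\<forall>z\<in>X. laplacian h z \<le> R) \<longrightarrow> 0 \<le> R \<longrightarrow>
    M - h (snd p) \<le> C * (M - h (fst p) + R)"
    using quantitative_max_principle by auto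
  then obtain c where c: "\<And>p. p \<in> X \<times> X \<Longrightarrow> 0 \<le> c p"
    "\<And>p h M R. p \<in> X \<times> X \<Longrightarrow> (\<forall>z\<in>X. h z \<le> M) \<Longrightarrow> (\<forall>z\<in>X. laplacian h z \<le> R) \<Longrightarrow> 0 \<le> R \<Longrightarrow>
      M - h (snd p) \<le> c p * (M - h (fst p) + R)"
    by metis
  \<comment> \<open>One constant for all positions of the two points, which vary with
    \<open>h\<close>.\<close>
  define C where "C = (\<Sum>p\<in>X \<times> X. c p)"
  have C: "0 \<le> C" "\<And>p. p \<in> X \<times> X \<Longrightarrow> c p \<le> C"
    unfolding C_def using c(1) fin by (auto intro!: sum_nonneg member_le_sum)
  have upper: "h y \<le> C * (\<Sum>x\<in>X. \<bar>laplacian h x\<bar>)"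
    if h: "(\<Sum>x\<in>X. \<pi> x * h x) = 0" and y: "y \<in> X" for h y
  proof -
    define R where "R = (\<Sum>x\<in>X. \<bar>laplacian h x\<bar>)"
    have "\<bar>laplacian h z\<bar> \<le> R" if "z \<in> X" for z
      unfolding R_def using fin that by (intro member_le_sum) auto
    then have R: "0 \<le> R" "\<forall>z\<in>X. laplacian h z \<le> R"
      by (auto simp: R_def sum_nonneg abs_le_iff)
    have "\<exists>z\<in>X. h z \<le> 0"
    proof (rule ccontr)
      assume "\<not> (\<exists>z\<in>X. h z \<le> 0)"
      then have "0 < (\<Sum>x\<in>X. \<pi> x * h x)"
        using \<pi> fin nonempty by (intro sum_pos) (auto simp: not_le)
      with h show False by simp
    qed
    then obtain z where z: "z \<in> X" "h z \<le> 0"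
      by blast
    have fimg: "finite (h ` X)" "h ` X \<noteq> {}"
      using fin nonempty by auto
    from Max_in[OF this] obtain x where x: "x \<in> X" "h x = Max (h ` X)"
      by (metis imageE)
    then have max: "\<forall>w\<in>X. h w \<le> h x"
      using fimg(1) by auto
    have "h y \<le> h x - h z"
      using max y z(2) by force
    also have "\<dots> \<le> c (x, z) * R"
      using c(2)[of "(x, z)", OF _ max R(2,1)] x(1) z(1) by simp
    also have "\<dots> \<le> C * R"
      using C(2)[of "(x, z)"] x(1) z(1) R by (intro mult_right_mono) auto
    finally show ?thesis
      unfolding R_def .
  qed
  have "\<bar>h y\<bar> \<le> C * (\<Sum>x\<in>X. \<bar>laplacian h x\<bar>)"
    if h: "(\<Sum>x\<in>X. \<pi> x * h x) = 0" and y: "y \<in> X" for h y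
  proof -
    have "laplacian (\<lambda>x. - h x) x = - laplacian h x" for x
      unfolding laplacian_def sum_negf[symmetric] by (intro sum.cong) (auto simp: algebra_simps)
    then have "- h y \<le> C * (\<Sum>x\<in>X. \<bar>laplacian h x\<bar>)"
      using upper[of "\<lambda>x. - h x" y] h y by (simp add: sum_negf)
    then show ?thesis
      using upper[OF h y] by (simp add: abs_le_iff)
  qed
  with C(1) show ?thesis by blast
qed

lemma bigo_of_laplacian:
  fixes \<pi> :: "'v \<Rightarrow> real" and h :: "'b \<Rightarrow> 'v \<Rightarrow> real" and g :: "'b \<Rightarrow> real"
  assumes \<pi>: "\<And>x. x \<in> X \<Longrightarrow> 0 < \<pi> x" and h: "\<And>t. (\<Sum>x\<in>X. \<pi> x * h t x) = 0"
    and lap: "\<And>x. x \<in> X \<Longrightarrow> (\<lambda>t. laplacian (h t) x) \<in> O[F](g)" and y: "y \<in> X"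
  shows "(\<lambda>t. h t y) \<in> O[F](g)"
proof -
  obtain C where C: "0 \<le> C" "\<And>h y. (\<Sum>x\<in>X. \<pi> x * h x) = 0 \<Longrightarrow> y \<in> X \<Longrightarrow>
      \<bar>h y\<bar> \<le> C * (\<Sum>x\<in>X. \<bar>laplacian h x\<bar>)"
    using bounded_by_laplacian[of \<pi>, OF \<pi>] by blast
  have "(\<lambda>t. h t y) \<in> O[F](\<lambda>t. \<Sum>x\<in>X. \<bar>laplacian (h t) x\<bar>)"
    using C(2)[OF h y] by (intro bigoI[of _ C] always_eventually) (auto simp: abs_of_nonneg sum_nonneg)
  also have "(\<lambda>t. \<Sum>x\<in>X. \<bar>laplacian (h t) x\<bar>) \<in> O[F](g)"
    using lap by (intro big_sum_in_bigo) simp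
  finally show ?thesis .
qed

end

section \<open>Positivity and uniqueness of stationary distributions\<close>

text \<open>At a state of mass 0 balance leaves only the inflow, which must vanish, so the states
  feeding it have mass 0 too. Hence \<open>A\<close> runs against the rates:
  \<open>(x, y) \<in> A\<close> gives \<open>k y x > 0\<close>.\<close>

lemma stationary_distribution_pos:
  fixes k :: "'v \<Rightarrow> 'v \<Rightarrow> real"
  assumes "finite X" and irr: "\<And>u v. u \<in> X \<Longrightarrow> v \<in> X \<Longrightarrow> (u, v) \<in> A\<^sup>*" and A: "A \<subseteq> X \<times> X"
    and k: "\<And>x y. x \<in> X \<Longrightarrow> y \<in> X \<Longrightarrow> 0 \<le> k x y" "\<And>x y. (x, y) \<in> A \<Longrightarrow> 0 < k y x"
    and \<pi>: "is_stationary_distribution X k \<pi>" and x: "x \<in> X"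
  shows "0 < \<pi> x"
proof (rule ccontr)
  assume "\<not> 0 < \<pi> x"
  have nn: "\<And>x. x \<in> X \<Longrightarrow> 0 \<le> \<pi> x" and one: "(\<Sum>x\<in>X. \<pi> x) = 1"
    and bal: "\<And>x. x \<in> X \<Longrightarrow> (\<Sum>y\<in>X. k x y * \<pi> x - k y x * \<pi> y) = 0"
    using \<pi> unfolding is_stationary_distribution_def by auto
  with x \<open>\<not> 0 < \<pi> x\<close> have zero: "\<pi> x = 0"
    by (simp add: order_antisym not_less)
  have "\<pi> y = 0" if "y \<in> X" for y
    using irr[OF x that]
  proof (induction rule: rtrancl_induct)
    case (step y z)
    then have yz: "y \<in> X" "z \<in> X"
      using A by auto
    have "(\<Sum>w\<in>X. k w y * \<pi> w) = 0"
      using bal[OF yz(1)] step.IH by (simp add: sum_negf)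
    then have "k z y * \<pi> z = 0"
      using nn k(1) yz \<open>finite X\<close> by (subst (asm) sum_nonneg_eq_0_iff) auto
    then show ?case
      using k(2)[OF step.hyps(2)] by simp
  qed (rule zero)
  then show False
    using one by simp
qed

text \<open>The relative density \<open>\<pi>' / \<pi> - 1\<close> has \<open>\<pi>\<close>-mean 0
  and is harmonic for the weights \<open>k y x * \<pi> y\<close>, the rates of the time-reversed
  process up to the factor \<open>\<pi> x\<close>; so it is 0.\<close>

lemma stationary_distribution_unique:
  fixes k :: "'v \<Rightarrow> 'v \<Rightarrow> real"
  assumes fin: "finite X" and irr: "\<And>u v. u \<in> X \<Longrightarrow> v \<in> X \<Longrightarrow> (u, v) \<in> A\<^sup>*" and A: "A \<subseteq> X \<times> X"
    and k: "\<And>x y. x \<in> X \<Longrightarrow> y \<in> X \<Longrightarrow> 0 \<le> k x y" "\<And>x y. (x, y) \<in> A \<Longrightarrow> 0 < k y x"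
    and \<pi>: "is_stationary_distribution X k \<pi>" and \<pi>': "is_stationary_distribution X k \<pi>'"
  shows "\<pi> = \<pi>'"
proof -
  have one: "(\<Sum>x\<in>X. \<pi> x) = 1" "(\<Sum>x\<in>X. \<pi>' x) = 1" and out: "\<And>x. x \<notin> X \<Longrightarrow> \<pi> x = \<pi>' x"
    and bal: "\<And>x. x \<in> X \<Longrightarrow> (\<Sum>y\<in>X. k x y * \<pi> x - k y x * \<pi> y) = 0"
      "\<And>x. x \<in> X \<Longrightarrow> (\<Sum>y\<in>X. k x y * \<pi>' x - k y x * \<pi>' y) = 0"
    using \<pi> \<pi>' unfolding is_stationary_distribution_def by auto
  have pos: "0 < \<pi> x" if "x \<in> X" for x
    by (rule stationary_distribution_pos[OF fin irr A k \<pi> that])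
  have "X \<noteq> {}"
    using one by auto
  have "0 \<le> k y x * \<pi> y" if "x \<in> X" "y \<in> X" for x y
    using k(1)[of y x] pos[of y] that by simp
  moreover have "0 < k y x * \<pi> y" if "(x, y) \<in> A" for x y
    using k(2)[OF that] pos[of y] that A by auto
  ultimately interpret irreducible_weights X A "\<lambda>x y. k y x * \<pi> y"
    using fin irr A \<open>X \<noteq> {}\<close> by unfold_locales
  define h where "h x = \<pi>' x / \<pi> x - 1" for x
  have \<pi>h: "\<pi> x * h x = \<pi>' x - \<pi> x" if "x \<in> X" for x
    using pos[OF that] unfolding h_def by (simp add: field_simps)
  have "(\<Sum>x\<in>X. \<pi> x * h x) = 0"
    using one by (simp add: \<pi>h sum_subtractf cong: sum.cong)
  moreover have "laplacian h x = 0" if x: "x \<in> X" for x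
  proof -
    have \<pi>'x: "\<pi>' x = \<pi> x + \<pi> x * h x"
      using \<pi>h[OF x] by simp
    have "laplacian h x = (\<Sum>y\<in>X. k y x * \<pi> y * h x - k y x * (\<pi> y * h y))"
      unfolding laplacian_def by (intro sum.cong) (auto simp: algebra_simps)
    also have "\<dots> = (\<Sum>y\<in>X. k y x * \<pi> y) * h x - (\<Sum>y\<in>X. k y x * (\<pi>' y - \<pi> y))"
      by (simp add: sum_subtractf sum_distrib_right \<pi>h cong: sum.cong)
    \<comment> \<open>Stationarity of \<pi> trades inflow for outflow, which leaves the difference
      of two balance equations.\<close>
    also have "(\<Sum>y\<in>X. k y x * \<pi> y) = (\<Sum>y\<in>X. k x y * \<pi> x)"
      using bal(1)[OF x] by (simp add: sum_subtractf)
    also have "(\<Sum>y\<in>X. k x y * \<pi> x) * h x - (\<Sum>y\<in>X. k y x * (\<pi>' y - \<pi> y)) =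
        (\<Sum>y\<in>X. k x y * \<pi>' x - k y x * \<pi>' y) - (\<Sum>y\<in>X. k x y * \<pi> x - k y x * \<pi> y)"
      unfolding sum_distrib_right sum_subtractf[symmetric]
      by (intro sum.cong) (auto simp: \<pi>'x algebra_simps)
    finally show ?thesis
      using bal x by simp
  qed
  ultimately have "h x = 0" if "x \<in> X" for x
    using bounded_by_laplacian[of \<pi>, OF pos] that by fastforce
  then show ?thesis
    using \<pi>h out by (metis eq_iff_diff_eq_0 ext mult_zero_right)
qed

section \<open>Second-order expansion of the stationary density\<close>

text \<open>With \<open>a = \<epsilon> * t / 2\<close> the second function is
  \<open>2 * a - 2 * sinh a\<close>, in fact of third order: the two half-size exponents together
  produce the full linear term \<open>\<epsilon> * t\<close>.\<close>

lemma exp_expansion_bigo: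
  fixes t :: real
  shows "(\<lambda>\<epsilon>. 1 - exp (\<epsilon> / 2 * t)) \<in> O[at 0](\<lambda>\<epsilon>. \<epsilon>)"
    and "(\<lambda>\<epsilon>. exp (- (\<epsilon> / 2 * t)) - exp (\<epsilon> / 2 * t) + \<epsilon> * t) \<in> O[at 0](\<lambda>\<epsilon>. \<epsilon>\<^sup>2)"
proof -
  consider "t = 0" | "t > 0" | "t < 0" by linarith
  then show "(\<lambda>\<epsilon>. 1 - exp (\<epsilon> / 2 * t)) \<in> O[at 0](\<lambda>\<epsilon>. \<epsilon>)"
    by cases (simp, real_asymp+)
  consider "t = 0" | "t > 0" | "t < 0" by linarith
  then show "(\<lambda>\<epsilon>. exp (- (\<epsilon> / 2 * t)) - exp (\<epsilon> / 2 * t) + \<epsilon> * t) \<in> O[at 0](\<lambda>\<epsilon>. \<epsilon>\<^sup>2)"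
    by cases (simp, real_asymp+)
qed

lemma first_order_response:
  fixes k s :: "'v \<Rightarrow> 'v \<Rightarrow> real" and \<pi> f :: "'v \<Rightarrow> real" and \<rho> :: "real \<Rightarrow> 'v \<Rightarrow> real"
  assumes weights: "irreducible_weights X A (\<lambda>x y. \<pi> x * k x y)"
    and pos: "\<And>x. x \<in> X \<Longrightarrow> 0 < \<pi> x" and one: "(\<Sum>x\<in>X. \<pi> x) = 1"
    and reversible: "\<And>x y. x \<in> X \<Longrightarrow> y \<in> X \<Longrightarrow> \<pi> x * k x y = \<pi> y * k y x"
    and antisym: "\<And>x y. x \<in> X \<Longrightarrow> y \<in> X \<Longrightarrow> k x y \<noteq> 0 \<Longrightarrow> s x y = - s y x"
    and \<rho>: "\<And>\<epsilon>. is_stationary_distribution X (perturbed_rate k s \<epsilon>) (\<rho> \<epsilon>)"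
    and f_mean: "(\<Sum>x\<in>X. \<pi> x * f x) = 0"
    and f_eq: "\<And>x. x \<in> X \<Longrightarrow> (\<Sum>y\<in>X. \<pi> x * k x y * (f x - f y + s x y)) = 0"
    and x: "x \<in> X"
  shows "(\<lambda>\<epsilon>. \<rho> \<epsilon> x / \<pi> x - (1 + \<epsilon> * f x)) \<in> O[at 0](\<lambda>\<epsilon>. \<epsilon>\<^sup>2)"
proof -
  interpret irreducible_weights X A "\<lambda>x y. \<pi> x * k x y"
    by (rule weights)
  define b where "b x y = \<pi> x * k x y" for x y
  define H where "H \<epsilon> x = \<rho> \<epsilon> x / \<pi> x" for \<epsilon> x
  have \<rho>H: "\<rho> \<epsilon> x = \<pi> x * H \<epsilon> x" if "x \<in> X" for \<epsilon> x
    using pos[OF that] unfolding H_def by simp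
  have \<rho>_one: "(\<Sum>x\<in>X. \<rho> \<epsilon> x) = 1" and \<rho>_nonneg: "\<And>x. x \<in> X \<Longrightarrow> 0 \<le> \<rho> \<epsilon> x" for \<epsilon>
    using \<rho>[of \<epsilon>] unfolding is_stationary_distribution_def by auto
  have H_mean: "(\<Sum>x\<in>X. \<pi> x * H \<epsilon> x) = 1" for \<epsilon>
    using \<rho>_one[of \<epsilon>] by (simp add: \<rho>H cong: sum.cong)
  \<comment> \<open>Reversibility gives both directions the same conductance, and antisymmetry makes
    their exponentials inverse. Where \<open>k x y = 0\<close> nothing is known about
    \<open>s\<close>, but both rates vanish.\<close>
  have balance: "(\<Sum>y\<in>X. b x y * (exp (\<epsilon> / 2 * s x y) * H \<epsilon> x - exp (- (\<epsilon> / 2 * s x y)) * H \<epsilon> y)) = 0"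
    if x: "x \<in> X" for \<epsilon> x
  proof -
    have "b x y * (exp (\<epsilon> / 2 * s x y) * H \<epsilon> x - exp (- (\<epsilon> / 2 * s x y)) * H \<epsilon> y) =
        perturbed_rate k s \<epsilon> x y * \<rho> \<epsilon> x - perturbed_rate k s \<epsilon> y x * \<rho> \<epsilon> y"
      if y: "y \<in> X" for y
    proof (cases "k x y = 0")
      case True
      then have "k y x = 0"
        using reversible[OF x y] pos[OF y] by simp
      with True show ?thesis
        unfolding b_def perturbed_rate_def by simp
    next
      case False
      then have s: "s y x = - s x y"
        using antisym[OF x y] by simp
      have "b x y = k y x * \<pi> y"
        unfolding b_def using reversible[OF x y] by simp
      then have yx: "b x y * (exp (- (\<epsilon> / 2 * s x y)) * H \<epsilon> y) =
          k y x * exp (- (\<epsilon> / 2 * s x y)) * (\<pi> y * H \<epsilon> y)"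
        by simp
      have xy: "b x y * (exp (\<epsilon> / 2 * s x y) * H \<epsilon> x) =
          k x y * exp (\<epsilon> / 2 * s x y) * (\<pi> x * H \<epsilon> x)"
        unfolding b_def by simp
      show ?thesis
        unfolding perturbed_rate_def right_diff_distrib \<rho>H[OF x] \<rho>H[OF y] s yx xy
        by simp
    qed
    then show ?thesis
      using \<rho>[of \<epsilon>] x unfolding is_stationary_distribution_def by simp
  qed
  \<comment> \<open>Subtracting the zero sum \<open>balance\<close> leaves factors
    \<open>1 - exp\<close> of order \<epsilon>. The free \<open>r\<close> is the approximation to be
    tested: first \<open>1\<close>, then \<open>1 + \<epsilon> * f\<close>.\<close>
  have lap_H: "laplacian (\<lambda>x. H \<epsilon> x - r x) x = (\<Sum>y\<in>X. b x y *
      ((1 - exp (\<epsilon> / 2 * s x y)) * H \<epsilon> x - (1 - exp (- (\<epsilon> / 2 * s x y))) * H \<epsilon> y - (r x - r y)))"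
    if x: "x \<in> X" for \<epsilon> x r
  proof -
    have "laplacian (\<lambda>x. H \<epsilon> x - r x) x =
      (\<Sum>y\<in>X. b x y * (H \<epsilon> x - r x - (H \<epsilon> y - r y))) -
      (\<Sum>y\<in>X. b x y * (exp (\<epsilon> / 2 * s x y) * H \<epsilon> x - exp (- (\<epsilon> / 2 * s x y)) * H \<epsilon> y))"
      unfolding laplacian_def balance[OF x] by (simp add: b_def)
    also have "\<dots> = (\<Sum>y\<in>X. b x y *
      ((1 - exp (\<epsilon> / 2 * s x y)) * H \<epsilon> x - (1 - exp (- (\<epsilon> / 2 * s x y))) * H \<epsilon> y - (r x - r y)))"
      unfolding sum_subtractf[symmetric] by (intro sum.cong) (auto simp: algebra_simps)
    finally show ?thesis .
  qed
  have exp_minus: "(\<lambda>\<epsilon>. 1 - exp (- (\<epsilon> / 2 * t))) \<in> O[at 0](\<lambda>\<epsilon>. \<epsilon>)" for t :: real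
    using exp_expansion_bigo(1)[of "- t"] by simp
  \<comment> \<open>The input of the first round: a probability is at most 1, uniformly in
    \<epsilon>.\<close>
  have H_bounded: "(\<lambda>\<epsilon>. H \<epsilon> x) \<in> O[at 0](\<lambda>_. 1)" if "x \<in> X" for x
  proof (intro bigoI[of _ "1 / \<pi> x"] always_eventually allI)
    fix \<epsilon>
    have "\<rho> \<epsilon> x \<le> (\<Sum>x\<in>X. \<rho> \<epsilon> x)"
      using that fin \<rho>_nonneg by (intro member_le_sum) auto
    then show "norm (H \<epsilon> x) \<le> 1 / \<pi> x * norm (1::real)"
      using \<rho>_one[of \<epsilon>] \<rho>_nonneg[OF that, of \<epsilon>] pos[OF that] unfolding H_def
      by (simp add: divide_right_mono)
  qed
  have first: "(\<lambda>\<epsilon>. H \<epsilon> x - 1) \<in> O[at 0](\<lambda>\<epsilon>. \<epsilon>)" if "x \<in> X" for x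
  proof (rule bigo_of_laplacian[where h = "\<lambda>\<epsilon> x. H \<epsilon> x - 1" and \<pi> = \<pi>, OF pos _ _ that])
    show "(\<Sum>x\<in>X. \<pi> x * (H \<epsilon> x - 1)) = 0" for \<epsilon>
      using H_mean[of \<epsilon>] one by (simp add: right_diff_distrib sum_subtractf)
    fix x
    assume x: "x \<in> X"
    have "(\<lambda>\<epsilon>. (1 - exp (\<epsilon> / 2 * s x y)) * H \<epsilon> x - (1 - exp (- (\<epsilon> / 2 * s x y))) * H \<epsilon> y - (1 - 1))
        \<in> O[at 0](\<lambda>\<epsilon>. \<epsilon>)" if "y \<in> X" for y
      using landau_o.big.mult[OF exp_expansion_bigo(1) H_bounded[OF x], of "s x y"]
        landau_o.big.mult[OF exp_minus H_bounded[OF that], of "s x y"]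
      by (simp add: sum_in_bigo)
    then show "(\<lambda>\<epsilon>. laplacian (\<lambda>x. H \<epsilon> x - 1) x) \<in> O[at 0](\<lambda>\<epsilon>. \<epsilon>)"
      unfolding lap_H[OF x] by (intro big_sum_in_bigo landau_o.big.cmult_in_iff') simp
  qed
  have "(\<lambda>\<epsilon>. H \<epsilon> x - (1 + \<epsilon> * f x)) \<in> O[at 0](\<lambda>\<epsilon>. \<epsilon>\<^sup>2)"
  proof (rule bigo_of_laplacian[where h = "\<lambda>\<epsilon> x. H \<epsilon> x - (1 + \<epsilon> * f x)" and \<pi> = \<pi>, OF pos _ _ x])
    fix \<epsilon>
    have "(\<Sum>x\<in>X. \<pi> x * (H \<epsilon> x - (1 + \<epsilon> * f x))) =
        (\<Sum>x\<in>X. \<pi> x * H \<epsilon> x) - (\<Sum>x\<in>X. \<pi> x) - \<epsilon> * (\<Sum>x\<in>X. \<pi> x * f x)"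
      unfolding sum_distrib_left sum_subtractf[symmetric]
      by (intro sum.cong) (auto simp: algebra_simps)
    then show "(\<Sum>x\<in>X. \<pi> x * (H \<epsilon> x - (1 + \<epsilon> * f x))) = 0"
      using H_mean one f_mean by simp
  next
    fix x
    assume x: "x \<in> X"
    \<comment> \<open>Writing \<open>H = 1 + (H - 1)\<close> splits the source into products of two
      terms of order \<epsilon>, the exponential remainder, and
      \<open>- \<epsilon> * (f x - f y + s x y)\<close>, whose weighted sum vanishes by
      \<open>f_eq\<close>.\<close>
    define D where "D \<epsilon> y = (1 - exp (\<epsilon> / 2 * s x y)) * (H \<epsilon> x - 1) -
      (1 - exp (- (\<epsilon> / 2 * s x y))) * (H \<epsilon> y - 1) +
      (exp (- (\<epsilon> / 2 * s x y)) - exp (\<epsilon> / 2 * s x y) + \<epsilon> * s x y)" for \<epsilon> y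
    have D: "(\<lambda>\<epsilon>. D \<epsilon> y) \<in> O[at 0](\<lambda>\<epsilon>. \<epsilon>\<^sup>2)" if "y \<in> X" for y
      unfolding D_def power2_eq_square
      by (intro sum_in_bigo(1)[OF sum_in_bigo(2)] landau_o.big.mult exp_expansion_bigo(1) exp_minus
          exp_expansion_bigo(2)[unfolded power2_eq_square] first x that)
    have "laplacian (\<lambda>x. H \<epsilon> x - (1 + \<epsilon> * f x)) x = (\<Sum>y\<in>X. b x y * D \<epsilon> y)" for \<epsilon>
    proof -
      have "laplacian (\<lambda>x. H \<epsilon> x - (1 + \<epsilon> * f x)) x =
          (\<Sum>y\<in>X. b x y * D \<epsilon> y) - \<epsilon> * (\<Sum>y\<in>X. b x y * (f x - f y + s x y))"
        unfolding lap_H[OF x] sum_distrib_left sum_subtractf[symmetric] D_def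
        by (intro sum.cong) (auto simp: algebra_simps)
      then show ?thesis
        using f_eq[OF x] unfolding b_def by simp
    qed
    then show "(\<lambda>\<epsilon>. laplacian (\<lambda>x. H \<epsilon> x - (1 + \<epsilon> * f x)) x) \<in> O[at 0](\<lambda>\<epsilon>. \<epsilon>\<^sup>2)"
      using D by (simp add: big_sum_in_bigo landau_o.big.cmult_in_iff')
  qed
  then show ?thesis
    unfolding H_def .
qed

section \<open>Tree representation of the response\<close>

context
  fixes G :: "'v pair_pre_digraph" and k s :: "'v \<Rightarrow> 'v \<Rightarrow> real" and \<pi> :: "'v \<Rightarrow> real"
  assumes G: "pair_graph G"
    and conn: "Digraph_Component.connected (with_proj G)"
    and k_nonneg: "\<And>x y. x \<in> pverts G \<Longrightarrow> y \<in> pverts G \<Longrightarrow> 0 \<le> k x y"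
    and k_support: "\<And>x y. x \<in> pverts G \<Longrightarrow> y \<in> pverts G \<Longrightarrow> k x y \<noteq> 0 \<longleftrightarrow> (x, y) \<in> parcs G"
    and s_antisym: "\<And>x y. (x, y) \<in> parcs G \<Longrightarrow> s x y = - s y x"
    and \<pi>_pos: "\<And>x. x \<in> pverts G \<Longrightarrow> 0 < \<pi> x"
    and \<pi>_sum: "(\<Sum>x\<in>pverts G. \<pi> x) = 1"
    and reversible: "\<And>x y. x \<in> pverts G \<Longrightarrow> y \<in> pverts G \<Longrightarrow> \<pi> x * k x y = \<pi> y * k y x"
begin

interpretation G: pair_graph G
  by (rule G)

text \<open>Here \<open>m\<close> is the weighted mean of the tree potentials. Each of these is
  fixed only up to a constant, but only differences of \<open>m\<close> enter. The second claim
  averages the tree defects.\<close>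

lemma tree_expectation_path_sum:
  obtains m where "\<And>x y. x \<in> pverts G \<Longrightarrow> y \<in> pverts G \<Longrightarrow>
      tree_expectation G k x (\<lambda>T. tree_path_sum s T y x) = m y - m x"
    and "\<And>x. x \<in> pverts G \<Longrightarrow> (\<Sum>y\<in>pverts G. \<pi> x * k x y * (s x y - (m x - m y))) = 0"
proof -
  let ?X = "pverts G" and ?A = "parcs G"
  let ?T = "{E. E \<subseteq> ?A \<and> tree_rel ?X E}"
  define c where "c x y = \<pi> x * k x y" for x y
  have X: "finite ?X" "?X \<noteq> {}" and irr: "\<And>u v. u \<in> ?X \<Longrightarrow> v \<in> ?X \<Longrightarrow> (u, v) \<in> ?A\<^sup>*"
    using conn G.pair_finite_verts unfolding connected_with_proj_iff[OF G.pair_sym_digraph_axioms]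
    by auto
  have "(u, u) \<notin> ?A" for u
    using G.pair_no_loops[of "(u, u)"] by auto
  then have A: "?A \<subseteq> ?X \<times> ?X" "sym ?A" "irrefl ?A" "finite ?A"
    using G.pair_sym_arcs G.pair_finite_arcs
    by (auto simp: symmetric_def irrefl_def dest: G.in_arcsD1 G.in_arcsD2)
  have c_sym: "c x y = c y x" if "(x, y) \<in> ?A" for x y
    unfolding c_def using reversible that A(1) by blast
  have c_pos: "0 < c x y" if "(x, y) \<in> ?A" for x y
  proof -
    have xy: "x \<in> ?X" "y \<in> ?X"
      using that A(1) by auto
    then have "0 < k x y"
      using k_nonneg[OF xy] k_support[OF xy] that by simp
    then show ?thesis
      unfolding c_def using \<pi>_pos xy by simp
  qed
  have c_zero: "c x y = 0" if "x \<in> ?X" "y \<in> ?X" "(x, y) \<notin> ?A" for x y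
    unfolding c_def using k_support that by auto
  have finE: "finite E" if "E \<in> ?T" for E
    using that A(4) finite_subset by blast
  have "\<forall>E\<in>?T. \<exists>\<phi>. \<forall>(u, v)\<in>E. \<phi> u - \<phi> v = s u v"
  proof
    fix E
    assume E: "E \<in> ?T"
    then show "\<exists>\<phi>. \<forall>(u, v)\<in>E. \<phi> u - \<phi> v = s u v"
      using finE[OF E] tree_relD[of ?X E] s_antisym by (intro ex_potential_rel) blast+
  qed
  then have "\<exists>\<phi>. \<forall>E\<in>?T. \<forall>(u, v)\<in>E. \<phi> E u - \<phi> E v = s u v"
    by (rule bchoice)
  then obtain \<phi> where "\<forall>E\<in>?T. \<forall>(u, v)\<in>E. \<phi> E u - \<phi> E v = s u v"
    by blast
  then have \<phi>: "\<phi> E u - \<phi> E v = s u v" if "E \<subseteq> ?A" "tree_rel ?X E" "(u, v) \<in> E" for E u v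
    using that by blast
  define Z where "Z = (\<Sum>E\<in>?T. tree_rel_weight c E)"
  define m where "m x = (\<Sum>E\<in>?T. tree_rel_weight c E * \<phi> E x) / Z" for x
  have finT: "finite ?T"
    using A(4) by (auto intro: finite_subset[of _ "Pow ?A"])
  have w_pos: "0 < tree_rel_weight c E" if "E \<in> ?T" for E
    unfolding tree_rel_weight_def using that c_pos by (intro prod_pos) auto
  have "?T \<noteq> {}"
    using ex_spanning_tree_rel[OF A(4,1,2) irr] by blast
  then have Z: "0 < Z"
    unfolding Z_def using finT w_pos by (intro sum_pos) auto
  have "tree_expectation G k x (\<lambda>T. tree_path_sum s T y x) = m y - m x"
    if x: "x \<in> ?X" and y: "y \<in> ?X" for x y
  proof -
    define P where "P = (\<Prod>u\<in>?X - {x}. \<pi> u)"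
    have P: "0 < P"
      unfolding P_def using \<pi>_pos by (intro prod_pos) auto
    have W: "in_tree_weight k \<lparr>pverts = ?X, parcs = E\<rparr> x = tree_rel_weight c E / P"
      if E: "E \<in> ?T" for E
    proof -
      let ?TE = "\<lparr>pverts = ?X, parcs = E\<rparr>"
      have "(\<Prod>u\<in>pverts ?TE - {x}. \<pi> u) * in_tree_weight k ?TE x = tree_rel_weight c (parcs ?TE)"
      proof (rule in_tree_weight_eq)
        show "c u v = c v u" "0 \<le> c u v" if "(u, v) \<in> parcs ?TE" for u v
          using that E c_sym[of u v] c_pos[of u v] by auto
      qed (use E x finE[OF E] in \<open>auto simp: c_def\<close>)
      then have "P * in_tree_weight k ?TE x = tree_rel_weight c E"
        by (simp add: P_def)
      then show ?thesis
        using P by (simp add: eq_divide_eq mult.commute)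
    qed
    have S: "tree_path_sum s \<lparr>pverts = ?X, parcs = E\<rparr> y x = \<phi> E y - \<phi> E x" if E: "E \<in> ?T" for E
      using E x y \<phi> by (intro tree_path_sum_eq_potential) auto
    have "tree_expectation G k x (\<lambda>T. tree_path_sum s T y x) =
        (\<Sum>E\<in>?T. (\<phi> E y - \<phi> E x) * (tree_rel_weight c E / P)) / (\<Sum>E\<in>?T. tree_rel_weight c E / P)"
      unfolding tree_expectation_def sum_spanning_trees[OF G X(2)]
      by (intro arg_cong2[where f = "(/)"] sum.cong refl) (simp_all only: W S)
    also have "\<dots> = (\<Sum>E\<in>?T. (\<phi> E y - \<phi> E x) * tree_rel_weight c E) / Z"
      using P by (simp add: Z_def flip: sum_divide_distrib)
    also have "\<dots> = m y - m x"
      unfolding m_def diff_divide_distrib[symmetric] sum_subtractf[symmetric]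
      by (intro arg_cong2[where f = "(/)"] sum.cong refl) (simp add: algebra_simps)
    finally show ?thesis .
  qed
  moreover have "(\<Sum>y\<in>?X. \<pi> x * k x y * (s x y - (m x - m y))) = 0" if x: "x \<in> ?X" for x
  proof -
    have "(\<Sum>E\<in>?T. \<Sum>y | (x, y) \<in> ?A. tree_rel_weight c E * (c x y * (s x y - (\<phi> E x - \<phi> E y)))) = 0"
      by (rule sum_tree_defects_eq_0[OF X(1) A(1-3) x c_sym less_imp_le[OF c_pos] s_antisym \<phi>])
    then have "0 = (\<Sum>y | (x, y) \<in> ?A. \<Sum>E\<in>?T. tree_rel_weight c E * (c x y * (s x y - (\<phi> E x - \<phi> E y))))"
      by (subst sum.swap) simp
    also have "\<dots> = (\<Sum>y | (x, y) \<in> ?A. Z * (c x y * (s x y - (m x - m y))))"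
    proof (intro sum.cong refl)
      fix y
      have "(\<Sum>E\<in>?T. tree_rel_weight c E * (c x y * (s x y - (\<phi> E x - \<phi> E y)))) =
          c x y * (s x y * Z - ((\<Sum>E\<in>?T. tree_rel_weight c E * \<phi> E x) -
            (\<Sum>E\<in>?T. tree_rel_weight c E * \<phi> E y)))"
        unfolding Z_def sum_distrib_left sum_subtractf[symmetric]
        by (intro sum.cong) (auto simp: algebra_simps)
      also have "\<dots> = Z * (c x y * (s x y - (m x - m y)))"
        using Z by (simp add: m_def field_simps)
      finally show "(\<Sum>E\<in>?T. tree_rel_weight c E * (c x y * (s x y - (\<phi> E x - \<phi> E y)))) = \<dots>" .
    qed
    also have "\<dots> = (\<Sum>y\<in>?X. Z * (c x y * (s x y - (m x - m y))))"
      using X(1) A(1) c_zero[OF x] by (intro sum.mono_neutral_left) auto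
    finally show ?thesis
      using Z by (simp add: c_def flip: sum_distrib_left)
  qed
  ultimately show ?thesis
    using that by blast
qed

text \<open>With \<mu> the \<open>\<pi>\<close>-mean of \<open>m\<close>, the coefficient is
  \<open>\<mu> - m x\<close>: the potential centred and with reversed sign, because the path sums
  end at \<open>x\<close>. Hence the plus sign before \<open>s x y\<close>.\<close>

lemma tree_response:
  defines "f \<equiv> \<lambda>x. \<Sum>y\<in>pverts G. \<pi> y * tree_expectation G k x (\<lambda>T. tree_path_sum s T y x)"
  shows "(\<Sum>x\<in>pverts G. \<pi> x * f x) = 0"
    and "x \<in> pverts G \<Longrightarrow> (\<Sum>y\<in>pverts G. \<pi> x * k x y * (f x - f y + s x y)) = 0"
proof -
  obtain m where m: "\<And>x y. x \<in> pverts G \<Longrightarrow> y \<in> pverts G \<Longrightarrow>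
      tree_expectation G k x (\<lambda>T. tree_path_sum s T y x) = m y - m x"
    and kirchhoff: "\<And>x. x \<in> pverts G \<Longrightarrow>
      (\<Sum>y\<in>pverts G. \<pi> x * k x y * (s x y - (m x - m y))) = 0"
    using tree_expectation_path_sum by blast
  define \<mu> where "\<mu> = (\<Sum>y\<in>pverts G. \<pi> y * m y)"
  have f: "f x = \<mu> - m x" if "x \<in> pverts G" for x
  proof -
    have "f x = (\<Sum>y\<in>pverts G. \<pi> y * m y - \<pi> y * m x)"
      unfolding f_def using that by (intro sum.cong) (auto simp: m right_diff_distrib)
    also have "\<dots> = \<mu> - m x"
      unfolding sum_subtractf \<mu>_def sum_distrib_right[symmetric] using \<pi>_sum by simp
    finally show ?thesis .
  qed
  have "(\<Sum>x\<in>pverts G. \<pi> x * f x) = (\<Sum>x\<in>pverts G. \<pi> x * \<mu> - \<pi> x * m x)"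
    by (intro sum.cong) (auto simp: f right_diff_distrib)
  also have "\<dots> = 0"
    unfolding sum_subtractf \<mu>_def[symmetric] sum_distrib_right[symmetric] using \<pi>_sum by simp
  finally show "(\<Sum>x\<in>pverts G. \<pi> x * f x) = 0" .
  show "(\<Sum>y\<in>pverts G. \<pi> x * k x y * (f x - f y + s x y)) = 0" if x: "x \<in> pverts G"
    unfolding kirchhoff[OF x, symmetric] using x by (intro sum.cong) (auto simp: f)
qed

end

lemma ex1_stationary_distribution:
  fixes k :: "'v \<Rightarrow> 'v \<Rightarrow> real"
  assumes "finite X" and "X \<noteq> {}" and "\<And>u v. u \<in> X \<Longrightarrow> v \<in> X \<Longrightarrow> (u, v) \<in> A\<^sup>*" and "A \<subseteq> X \<times> X"
    and "\<And>x y. x \<in> X \<Longrightarrow> y \<in> X \<Longrightarrow> 0 \<le> k x y" and "\<And>x y. (x, y) \<in> A \<Longrightarrow> 0 < k y x"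
  shows "\<exists>!\<pi>. is_stationary_distribution X k \<pi>"
  using ex_stationary_distribution[of X k, OF assms(1,2,5)]
    stationary_distribution_unique[of X A k, OF assms(1,3-6)]
  by blast

theorem mainTheorem2:
  fixes G :: "'v pair_pre_digraph"
    and V :: "'v \<Rightarrow> real"
    and k_eq s :: "'v \<Rightarrow> 'v \<Rightarrow> real"
    and \<rho> :: "real \<Rightarrow> 'v \<Rightarrow> real"
  defines "\<rho> \<equiv> \<lambda>\<epsilon>. stationary_distribution (pverts G) (perturbed_rate k_eq s \<epsilon>)"
  assumes graph: "pair_graph G"
    and conn: "Digraph_Component.connected (with_proj G)"
    and k_nonneg: "\<And>x y. x \<in> pverts G \<Longrightarrow> y \<in> pverts G \<Longrightarrow> 0 \<le> k_eq x y"
    and k_support: "\<And>x y. x \<in> pverts G \<Longrightarrow> y \<in> pverts G \<Longrightarrow>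
                      k_eq x y \<noteq> 0 \<longleftrightarrow> (x, y) \<in> parcs G"
    and detailed_balance: "\<And>x y. (x, y) \<in> parcs G \<Longrightarrow> k_eq x y / k_eq y x = exp (V x - V y)"
    and s_antisym: "\<And>x y. (x, y) \<in> parcs G \<Longrightarrow> s x y = - s y x"
  shows "(\<forall>\<epsilon>. \<exists>!\<pi>. is_stationary_distribution (pverts G) (perturbed_rate k_eq s \<epsilon>) \<pi>) \<and>
    (\<exists>c>0. \<forall>x\<in>pverts G. \<rho> 0 x = c * exp (- V x)) \<and>
    (\<forall>x\<in>pverts G.
      (\<lambda>\<epsilon>. \<rho> \<epsilon> x / \<rho> 0 x -
        (1 + \<epsilon> * (\<Sum>y\<in>pverts G.
          \<rho> 0 y * tree_expectation G k_eq x (\<lambda>T. tree_path_sum s T y x))))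
      \<in> O[at 0](\<lambda>\<epsilon>. \<epsilon>\<^sup>2))"
proof -
  interpret G: pair_graph G by (rule graph)
  let ?X = "pverts G" and ?A = "parcs G"
  have X: "finite ?X" "?X \<noteq> {}" and irr: "\<And>u v. u \<in> ?X \<Longrightarrow> v \<in> ?X \<Longrightarrow> (u, v) \<in> ?A\<^sup>*"
    using conn G.pair_finite_verts unfolding connected_with_proj_iff[OF G.pair_sym_digraph_axioms]
    by auto
  have A: "?A \<subseteq> ?X \<times> ?X" and sym: "sym ?A"
    using G.pair_sym_arcs by (auto simp: symmetric_def dest: G.in_arcsD1 G.in_arcsD2)
  have k_pos: "0 < k_eq x y" if "(x, y) \<in> ?A" for x y
  proof -
    have "x \<in> ?X" "y \<in> ?X"
      using that A by auto
    with that show ?thesis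
      using k_nonneg[of x y] k_support[of x y] by simp
  qed
  \<comment> \<open>The exponential factor is positive, so the perturbed rates keep the support of
    \<open>k_eq\<close> and irreducibility persists for every \<epsilon>.\<close>
  have ex1: "\<exists>!\<pi>. is_stationary_distribution ?X (perturbed_rate k_eq s \<epsilon>) \<pi>" for \<epsilon>
    using k_nonneg k_pos symD[OF sym] unfolding perturbed_rate_def
    by (intro ex1_stationary_distribution[OF X irr A]) auto
  have \<rho>: "is_stationary_distribution ?X (perturbed_rate k_eq s \<epsilon>) (\<rho> \<epsilon>)" for \<epsilon>
    unfolding \<rho>_def stationary_distribution_def by (rule theI'[OF ex1])
  define Z where "Z = (\<Sum>x\<in>?X. exp (- V x))"
  define g where "g x = (if x \<in> ?X then exp (- V x) / Z else 0)" for x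
  have Z: "0 < Z"
    unfolding Z_def using X by (intro sum_pos) auto
  have g_pos: "0 < g x" if "x \<in> ?X" for x
    using that Z unfolding g_def by simp
  have g_sum: "(\<Sum>x\<in>?X. g x) = 1"
    using Z unfolding g_def by (simp add: Z_def flip: sum_divide_distrib)
  have reversible: "g x * k_eq x y = g y * k_eq y x" if xy: "x \<in> ?X" "y \<in> ?X" for x y
  proof (cases "(x, y) \<in> ?A")
    case True
    then have "k_eq x y = exp (V x - V y) * k_eq y x"
      using detailed_balance[OF True] k_pos[of y x] symD[OF sym True] by (simp add: field_simps)
    moreover have "exp (- V x) * exp (V x - V y) = exp (- V y)"
      by (simp flip: exp_add)
    ultimately show ?thesis
      using xy by (simp add: g_def flip: mult.assoc)
  next
    case False
    then have "(y, x) \<notin> ?A"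
      using symD[OF sym] by blast
    with False show ?thesis
      using k_support[of x y] k_support[of y x] xy by simp
  qed
  \<comment> \<open>At \<epsilon> = 0 the balance sums vanish term by term; uniqueness then
    identifies \<open>\<rho> 0\<close> with the Gibbs distribution.\<close>
  have "is_stationary_distribution ?X (perturbed_rate k_eq s 0) g"
    unfolding is_stationary_distribution_def
  proof (intro conjI ballI allI impI)
    fix x
    assume x: "x \<in> ?X"
    show "0 \<le> g x"
      using g_pos[OF x] by simp
    show "(\<Sum>y\<in>?X. perturbed_rate k_eq s 0 x y * g x - perturbed_rate k_eq s 0 y x * g y) = 0"
      using reversible[OF x] by (intro sum.neutral) (auto simp: perturbed_rate_def mult.commute)
  qed (use g_sum in \<open>simp_all add: g_def\<close>)
  then have \<rho>0: "\<rho> 0 = g"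
    using ex1 \<rho> by blast
  have Gibbs: "\<exists>c>0. \<forall>x\<in>?X. \<rho> 0 x = c * exp (- V x)"
    using Z by (intro exI[of _ "1 / Z"]) (auto simp: \<rho>0 g_def)
  have weights: "irreducible_weights ?X ?A (\<lambda>x y. g x * k_eq x y)"
  proof
    show "0 \<le> g u * k_eq u v" if "u \<in> ?X" "v \<in> ?X" for u v
      using g_pos[of u] k_nonneg[of u v] that by simp
    show "0 < g u * k_eq u v" if "(u, v) \<in> ?A" for u v
      using g_pos[of u] k_pos[OF that] A that by auto
  qed (use X irr A in auto)
  have antisym: "s x y = - s y x" if "x \<in> ?X" "y \<in> ?X" "k_eq x y \<noteq> 0" for x y
    using k_support s_antisym that by blast
  have response: "(\<lambda>\<epsilon>. \<rho> \<epsilon> x / g x -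
        (1 + \<epsilon> * (\<Sum>y\<in>?X. g y * tree_expectation G k_eq x (\<lambda>T. tree_path_sum s T y x))))
      \<in> O[at 0](\<lambda>\<epsilon>. \<epsilon>\<^sup>2)" if x: "x \<in> ?X" for x
    by (rule first_order_response[OF weights _ g_sum _ _ \<rho> _ _ x])
      (rule g_pos reversible antisym tree_response[OF graph conn k_nonneg k_support s_antisym g_pos
          g_sum reversible]; assumption)+
  show ?thesis
    unfolding \<rho>0 using ex1 Gibbs[unfolded \<rho>0] response by blast
qed

end
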